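(* Let $\Pi\colon[0,T]\times\Omega_W\to\mathbb{N}_0$ be a Poisson process with intensity $a\in(0,\infty)$. Then, for any $p\in[2,\infty)$ and $\sigma\in(0,1)$ with $\sigma p<1$ we have $$\Pi\in L^p(\Omega_W;W^{\sigma,p}(0,T)).$$ In addition, for every $h_0\in(0,T]$ there exists $C_0\in(0,\infty)$ such that $$\int_0^h\mathbb{E}_W\big[|\Pi(t)|^p\big]\,\mathrm{d}t\le C_0\,h^{\max(0,\,p\sigma-\frac{p-2}{2})}\quad\text{for all } h\in(0,h_0].$$ In particular, every Poisson process with intensity $a\in(0,\infty)$ fulfills, as the integrand $G=\Pi$, all of the following conditions for every $p\in[2,\infty)$ and $\sigma\in(0,1)$ with $\sigma p<1$: $G\colon[0,T]\times\Omega_W\to\mathbb{R}$ is an $(\mathcal{F}^W_t)_{t\in[0,T]}$-progressively measurable stochastic process, $G\in L^p(\Omega_W;W^{\sigma,p}(0,T))$, and there exist $C_0\in(0,\infty)$ and $h_0\in(0,T]$ with $\int_0^h\mathbb{E}_W[|G(t)|^p]\,\mathrm{d}t\le C_0\,h^{\max(0,\,p\sigma-\frac{p-2}{2})}$ for all $h\in(0,h_0]$.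
   Context: Let $T\in(0,\infty)$ and let $(\Omega_W,\mathcal{F}^W,(\mathcal{F}^W_t)_{t\in[0,T]},\mathbb{P}_W)$ be a filtered probability space satisfying the usual conditions; $\mathbb{E}_W$ denotes expectation with respect to $\mathbb{P}_W$. A Poisson process $\Pi\colon[0,T]\times\Omega_W\to\mathbb{N}_0$ with intensity $a\in(0,\infty)$ is a stochastic process on $(\Omega_W,\mathcal{F}^W,\mathbb{P}_W)$ such that: (i) $\Pi(0)=0$ almost surely; (ii) for any $0\le t_0<t_1<\dots<t_n\le T$, $n\in\mathbb{N}$, the random variables $(\Pi(t_i)-\Pi(t_{i-1}))_{i\in\{1,\dots,n\}}$ are independent; (iii) for all $0\le s\le t\le T$ the law of the increment $\Pi(t)-\Pi(s)$ is the Poisson distribution with mean $a(t-s)$, that is, $\mathbb{P}_W(\Pi(t)-\Pi(s)=n)=\frac{(a(t-s))^n}{n!}\mathrm{e}^{-a(t-s)}$ for all $n\in\mathbb{N}_0$; (iv) the sample paths of $\Pi$ are càdlàg. For $p\in[1,\infty)$ and $\sigma\in(0,1)$ the fractional Sobolev space $W^{\sigma,p}(0,T)$ consists of all $v\in L^p(0,T)$ with $$\|v\|_{W^{\sigma,p}(0,T)}=\Big(\int_0^T|v(t)|^p\,\mathrm{d}t+\int_0^T\int_0^T\frac{|v(t)-v(s)|^p}{|t-s|^{1+\sigma p}}\,\mathrm{d}t\,\mathrm{d}s\Big)^{\frac1p}<\infty,$$ and $\|G\|_{L^p(\Omega_W;W^{\sigma,p}(0,T))}=\big(\mathbb{E}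_W[\|G\|^p_{W^{\sigma,p}(0,T)}]\big)^{1/p}$.
   Formalization: The progressive measurability claim additionally assumes that the Poisson process is adapted to the filtration; the given definition does not require this, and without it the claim fails, e.g. when every F_t consists of the events of probability 0 or 1. *)

theory Defs
  imports "HOL-Probability.Probability"
begin

text \<open>A filtered probability space with time set \<open>[0, T]\<close> satisfying the usual conditions.
  Only the values \<open>F t\<close> with \<open>t \<in> {0..T}\<close> matter, and of each \<open>F t\<close> only its \<open>\<sigma>\<close>-algebra.
  No right-continuity is required at \<open>T\<close>, the last time point.\<close>

locale usual_filtered_prob_space = prob_space M + complete_measure M
  for M :: "'w measure" +
  fixes F :: "real \<Rightarrow> 'w measure" and T :: real
  assumes T_pos: "0 < T"
    and subalg: "\<And>t. t \<in> {0..T} \<Longrightarrow> subalgebra M (F t)"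
    and filtration_mono: "\<And>s t. 0 \<le> s \<Longrightarrow> s \<le> t \<Longrightarrow> t \<le> T \<Longrightarrow> sets (F s) \<subseteq> sets (F t)"
    and null_sets_initial: "null_sets M \<subseteq> sets (F 0)"
    and right_continuous: "\<And>t. 0 \<le> t \<Longrightarrow> t < T \<Longrightarrow> sets (F t) = (\<Inter>s\<in>{t<..T}. sets (F s))"

definition adapted_process ::
  "(real \<Rightarrow> 'w measure) \<Rightarrow> real \<Rightarrow> (real \<Rightarrow> 'w \<Rightarrow> real) \<Rightarrow> bool" where
  "adapted_process F T G \<longleftrightarrow> (\<forall>t\<in>{0..T}. G t \<in> borel_measurable (F t))"

definition progressively_measurable ::
  "(real \<Rightarrow> 'w measure) \<Rightarrow> real \<Rightarrow> (real \<Rightarrow> 'w \<Rightarrow> real) \<Rightarrow> bool" where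
  "progressively_measurable F T G \<longleftrightarrow>
    (\<forall>t\<in>{0..T}. (\<lambda>(s, \<omega>). G s \<omega>) \<in> borel_measurable (restrict_space borel {0..t} \<Otimes>\<^sub>M F t))"

definition cadlag_on :: "real \<Rightarrow> (real \<Rightarrow> real) \<Rightarrow> bool" where
  "cadlag_on T x \<longleftrightarrow>
    (\<forall>t\<in>{0..<T}. (x \<longlongrightarrow> x t) (at_right t)) \<and>
    (\<forall>t\<in>{0<..T}. \<exists>l. (x \<longlongrightarrow> l) (at_left t))"

text \<open>Increments are formed in \<^typ>\<open>int\<close>, because subtraction on \<^typ>\<open>nat\<close> truncates and the
  paths are not required to be monotone.\<close>

definition poisson_process ::
  "'w measure \<Rightarrow> real \<Rightarrow> real \<Rightarrow> (real \<Rightarrow> 'w \<Rightarrow> nat) \<Rightarrow> bool" where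
  "poisson_process M T a N \<longleftrightarrow>
    (\<forall>t\<in>{0..T}. N t \<in> measurable M (count_space UNIV)) \<and>
    (AE \<omega> in M. N 0 \<omega> = 0) \<and>
    (\<forall>n\<ge>1. \<forall>t :: nat \<Rightarrow> real. 0 \<le> t 0 \<and> strict_mono_on {0..n} t \<and> t n \<le> T \<longrightarrow>
      prob_space.indep_vars M (\<lambda>_. count_space UNIV)
        (\<lambda>i \<omega>. int (N (t i) \<omega>) - int (N (t (i - 1)) \<omega>)) {1..n}) \<and>
    (\<forall>s t. 0 \<le> s \<and> s \<le> t \<and> t \<le> T \<longrightarrow>
      (\<forall>n :: nat. measure M {\<omega> \<in> space M. int (N t \<omega>) - int (N s \<omega>) = int n}
        = (a * (t - s)) ^ n / fact n * exp (- (a * (t - s))))) \<and>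
    (\<forall>\<omega>\<in>space M. cadlag_on T (\<lambda>t. real (N t \<omega>)))"

text \<open>The \<open>p\<close>-th power of the norm of \<open>W\<^bsup>\<sigma>,p\<^esup>(0,T)\<close>, as an extended nonnegative number. The
  integrand of the double integral is \<open>0\<close> on the diagonal, which is a null set.\<close>

definition frac_sobolev_energy :: "real \<Rightarrow> real \<Rightarrow> real \<Rightarrow> (real \<Rightarrow> real) \<Rightarrow> ennreal" where
  "frac_sobolev_energy T \<sigma> p v =
    (\<integral>\<^sup>+t. ennreal (\<bar>v t\<bar> powr p) \<partial>lebesgue_on {0<..<T}) +
    (\<integral>\<^sup>+s. (\<integral>\<^sup>+t. ennreal (\<bar>v t - v s\<bar> powr p / \<bar>t - s\<bar> powr (1 + \<sigma> * p))
        \<partial>lebesgue_on {0<..<T}) \<partial>lebesgue_on {0<..<T})"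

text \<open>Elements are represented by functions rather than by classes modulo equality almost
  everywhere; values outside \<open>(0,T)\<close> are irrelevant.\<close>

definition frac_sobolev :: "real \<Rightarrow> real \<Rightarrow> real \<Rightarrow> (real \<Rightarrow> real) set" where
  "frac_sobolev T \<sigma> p =
    {v. v \<in> borel_measurable (lebesgue_on {0<..<T}) \<and> frac_sobolev_energy T \<sigma> p v < \<infinity>}"

text \<open>Only meaningful on \<^const>\<open>frac_sobolev\<close>: \<^const>\<open>enn2real\<close> maps \<open>\<infinity>\<close> to \<open>0\<close>.\<close>

definition frac_sobolev_norm :: "real \<Rightarrow> real \<Rightarrow> real \<Rightarrow> (real \<Rightarrow> real) \<Rightarrow> real" where
  "frac_sobolev_norm T \<sigma> p v = enn2real (frac_sobolev_energy T \<sigma> p v) powr (1 / p)"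

text \<open>The Bochner space \<open>L\<^sup>p(\<Omega>; W\<^bsup>\<sigma>,p\<^esup>(0,T))\<close>: almost all paths lie in \<open>W\<^bsup>\<sigma>,p\<^esup>(0,T)\<close>, the path map
  is strongly measurable, i.e. almost everywhere the limit in norm of simple functions with values
  in \<open>W\<^bsup>\<sigma>,p\<^esup>(0,T)\<close>, and the \<open>p\<close>-th moment of the norm is finite.\<close>

definition Lp_frac_sobolev ::
  "'w measure \<Rightarrow> real \<Rightarrow> real \<Rightarrow> real \<Rightarrow> (real \<Rightarrow> 'w \<Rightarrow> real) set" where
  "Lp_frac_sobolev M T \<sigma> p = {G.
    (AE \<omega> in M. (\<lambda>t. G t \<omega>) \<in> frac_sobolev T \<sigma> p) \<and>
    (\<exists>S :: nat \<Rightarrow> 'w \<Rightarrow> real \<Rightarrow> real.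
      (\<forall>n. simple_function M (S n) \<and> S n ` space M \<subseteq> frac_sobolev T \<sigma> p) \<and>
      (AE \<omega> in M. (\<lambda>n. frac_sobolev_norm T \<sigma> p (\<lambda>t. S n \<omega> t - G t \<omega>)) \<longlonglongrightarrow> 0)) \<and>
    (\<integral>\<^sup>+\<omega>. ennreal (frac_sobolev_norm T \<sigma> p (\<lambda>t. G t \<omega>) powr p) \<partial>M) < \<infinity>}"

text \<open>\<open>\<integral>\<^sub>0\<^sup>h E[|G(t)|\<^sup>p] dt\<close>, possibly infinite.\<close>

definition initial_moment ::
  "'w measure \<Rightarrow> real \<Rightarrow> (real \<Rightarrow> 'w \<Rightarrow> real) \<Rightarrow> real \<Rightarrow> ennreal" where
  "initial_moment M p G h =
    (\<integral>\<^sup>+t\<in>{0..h}. (\<integral>\<^sup>+\<omega>. ennreal (\<bar>G t \<omega>\<bar> powr p) \<partial>M) \<partial>lborel)"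

definition admissible_integrand ::
  "'w measure \<Rightarrow> (real \<Rightarrow> 'w measure) \<Rightarrow> real \<Rightarrow> real \<Rightarrow> real \<Rightarrow> (real \<Rightarrow> 'w \<Rightarrow> real) \<Rightarrow> bool" where
  "admissible_integrand M F T \<sigma> p G \<longleftrightarrow>
    progressively_measurable F T G \<and>
    G \<in> Lp_frac_sobolev M T \<sigma> p \<and>
    (\<exists>C0>0. \<exists>h0\<in>{0<..T}. \<forall>h\<in>{0<..h0}.
      initial_moment M p G h \<le> ennreal (C0 * h powr max 0 (p * \<sigma> - (p - 2) / 2)))"

end

theory Submission
  imports Defs
begin

text \<open>The whole theorem rests on one property of the Poisson distribution: for means \<open>\<mu>\<close> in a bounded
  range the \<open>p\<close>-th moment is at most \<open>C \<mu>\<close>, because only outcomes \<open>n \<ge> 1\<close> contribute and their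
  probabilities carry a factor \<open>\<mu>\<close> (\<open>poisson_moment_le_linear\<close>). Hence
  \<open>E[|N t - N s|\<^sup>p] \<le> C |t - s|\<close> on \<open>[0,T]\<close>. With \<open>s = 0\<close> this gives \<open>\<integral>\<^sub>0\<^sup>h E[|N t|\<^sup>p] dt \<le> C T h\<close>; the
  exponent of \<open>h\<close> in the claim is at most \<open>1\<close> since \<open>p \<ge> 2\<close> and \<open>\<sigma> p < 1\<close>, so the initial moment bound
  follows. By Tonelli the expected Sobolev energy is at most a constant plus
  \<open>C \<integral>\<integral> |t - s| |t - s|\<^bsup>-(1 + \<sigma> p)\<^esup> dt ds\<close>, which is finite because \<open>\<sigma> p < 1\<close>.

  Tonelli needs joint measurability in time and chance. A right-continuous process is the pointwise
  limit of its values at the next point of ever finer grids, and each of these approximations takes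
  countably many times only (\<open>right_continuous_jointly_measurable\<close>). Applied to \<open>F t\<close> on \<open>[0,t]\<close>
  in place of the full \<open>\<sigma>\<close>-algebra, the same fact is progressive measurability.

  Strong measurability of the path map requires simple functions converging in the Sobolev norm. The
  approximation samples the path at the left end points of the \<open>m = 2\<^sup>n\<close> cells of a uniform grid of
  mesh \<open>\<delta> = T / m\<close>, and truncates the values at \<open>n\<close>; the truncation is eventually inactive, since
  almost all paths are bounded on the grids by their value at \<open>T\<close>. For the sampling error \<open>D\<close>,
  \<open>E[|D t - D s|\<^sup>p]\<close> is at most \<open>C |t - s|\<close> if \<open>s\<close> and \<open>t\<close> lie in the same cell and of order \<open>\<delta>\<close>
  otherwise. With \<open>b = (1 + \<sigma> p) / 2 \<in> [1/2, 1)\<close> the kernel is \<open>|t - s|\<^bsup>-2b\<^esup>\<close>. Inside a cell,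
  \<open>|t - s|\<^bsup>1 - 2b\<^esup> \<le> \<delta>\<^bsup>1 - b\<^esup> |t - s|\<^bsup>-b\<^esup>\<close>. Across cells \<open>|t - s|\<close> is at least the distance \<open>d\<close> of \<open>s\<close> to the
  boundary of its cell, so that \<open>|t - s|\<^bsup>-2b\<^esup> \<le> d\<^bsup>-b\<^esup> |t - s|\<^bsup>-b\<^esup>\<close>, and \<open>d\<^bsup>-b\<^esup>\<close> has integral of order
  \<open>m \<delta>\<^bsup>1 - b\<^esup>\<close>. Only the integrable singularity of exponent \<open>-b\<close> is thus left, and the expected energy
  of the error is of order \<open>\<delta>\<^bsup>1 - b\<^esup>\<close> (\<open>double_integral_grid_bound\<close>). Along \<open>m = 2\<^sup>n\<close> this is a
  geometric series, whose summability upgrades convergence in the mean to almost sure convergence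
  (\<open>AE_tendsto_0_if_summable_nn_integral\<close>). The same double integral bound, with one cell, proves the
  energy of \<open>N\<close> itself finite, and, with \<open>A = 0\<close>, shows that step functions lie in the Sobolev space.\<close>

section \<open>The integrable singularity\<close>

lemma nn_integral_abs_powr_le:
  fixes c l b :: real
  assumes "0 \<le> l" "0 < b" "b < 1"
  shows "(\<integral>\<^sup>+t\<in>{c - l..c + l}. ennreal (\<bar>t - c\<bar> powr - b) \<partial>lborel)
    \<le> ennreal (2 * l powr (1 - b) / (1 - b))"
proof -
  let ?h = "\<lambda>t::real. ennreal (\<bar>t\<bar> powr - b) * indicator {0..l} t"
  have half: "(\<integral>\<^sup>+t. ?h t \<partial>lborel) = ennreal (l powr (1 - b) / (1 - b))"
  proof -
    have "((\<lambda>x. x powr - b) has_integral (l powr (1 - b) / (1 - b))) {0..l}"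
      using has_integral_powr_from_0[of "- b" l] assms by (simp add: add.commute)
    then have *: "((\<lambda>x. \<bar>x\<bar> powr - b * indicator {0..l} x) has_integral (l powr (1 - b) / (1 - b))) UNIV"
      by (subst (asm) has_integral_restrict_UNIV[symmetric])
         (erule has_integral_eq[rotated], auto)
    have "integral\<^sup>N lborel (\<lambda>x. ennreal (\<bar>x\<bar> powr - b * indicator {0..l} x)) = l powr (1 - b) / (1 - b)"
      by (rule nn_integral_has_integral_lborel[OF _ _ *]) auto
    then show ?thesis
      by (simp add: ennreal_mult'' ennreal_indicator[symmetric])
  qed
  have "(\<integral>\<^sup>+t\<in>{c - l..c + l}. ennreal (\<bar>t - c\<bar> powr - b) \<partial>lborel)
    = (\<integral>\<^sup>+t. ennreal (\<bar>t\<bar> powr - b) * indicator {- l..l} t \<partial>lborel)"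
    by (subst nn_integral_real_affine[where c = 1 and t = c])
       (auto intro!: nn_integral_cong split: split_indicator)
  also have "\<dots> \<le> (\<integral>\<^sup>+t. ?h t + ?h (- t) \<partial>lborel)"
    by (intro nn_integral_mono) (auto split: split_indicator)
  also have "\<dots> = (\<integral>\<^sup>+t. ?h t \<partial>lborel) + (\<integral>\<^sup>+t. ?h (- t) \<partial>lborel)"
    by (intro nn_integral_add) auto
  also have "(\<integral>\<^sup>+t. ?h (- t) \<partial>lborel) = (\<integral>\<^sup>+t. ?h t \<partial>lborel)"
    by (subst (2) nn_integral_real_affine[where c = "-1" and t = 0]) auto
  finally show ?thesis
    using assms by (simp add: half ennreal_plus[symmetric] del: ennreal_plus)
qed

text \<open>For a Borel function the completion in \<^const>\<open>lebesgue\<close> does not change the integral.\<close>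

lemma nn_integral_lebesgue_on:
  assumes "S \<in> sets borel" "f \<in> borel_measurable borel"
  shows "(\<integral>\<^sup>+t. f t \<partial>lebesgue_on S) = (\<integral>\<^sup>+t\<in>S. f t \<partial>lborel)"
  using assms by (simp add: nn_integral_restrict_space nn_integral_completion)

abbreviation time_measure :: "real \<Rightarrow> real measure" where
  "time_measure T \<equiv> lebesgue_on {0<..<T}"

lemma nn_integral_abs_powr_le_interval:
  fixes c T b :: real
  assumes "0 < T" "0 < b" "b < 1" "c \<in> {0..T}"
  shows "(\<integral>\<^sup>+t. ennreal (\<bar>t - c\<bar> powr - b) \<partial>time_measure T)
    \<le> ennreal (2 * T powr (1 - b) / (1 - b))"
proof -
  have "(\<integral>\<^sup>+t. ennreal (\<bar>t - c\<bar> powr - b) \<partial>time_measure T)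
    = (\<integral>\<^sup>+t\<in>{0<..<T}. ennreal (\<bar>t - c\<bar> powr - b) \<partial>lborel)"
    by (rule nn_integral_lebesgue_on) auto
  also have "\<dots> \<le> (\<integral>\<^sup>+t\<in>{c - T..c + T}. ennreal (\<bar>t - c\<bar> powr - b) \<partial>lborel)"
    using assms by (intro nn_integral_mono) (auto split: split_indicator)
  also have "\<dots> \<le> ennreal (2 * T powr (1 - b) / (1 - b))"
    using assms by (intro nn_integral_abs_powr_le) auto
  finally show ?thesis .
qed

section \<open>Uniform grids\<close>

text \<open>Cells are half-open on the right. The index is an integer, so that \<open>grid_point\<close>, the left end point
  of the cell containing \<open>t\<close>, is at most \<open>t\<close> on the whole line.\<close>

definition grid_index :: "real \<Rightarrow> nat \<Rightarrow> real \<Rightarrow> int" where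
  "grid_index T m t = \<lfloor>real m * t / T\<rfloor>"

definition grid_point :: "real \<Rightarrow> nat \<Rightarrow> real \<Rightarrow> real" where
  "grid_point T m t = of_int (grid_index T m t) * (T / real m)"

lemma borel_measurable_grid_point [measurable]: "grid_point T m \<in> borel_measurable borel"
  unfolding grid_point_def[abs_def] grid_index_def by measurable

lemma grid_point_bounds:
  assumes "0 < T" "0 < m"
  shows "grid_point T m t \<le> t" "t < grid_point T m t + T / real m"
proof -
  have d: "0 < T / real m" using assms by simp
  have "of_int (grid_index T m t) \<le> real m * t / T" "real m * t / T < of_int (grid_index T m t) + 1"
    unfolding grid_index_def by linarith+
  then have "of_int (grid_index T m t) * (T / real m) \<le> (real m * t / T) * (T / real m)"
    "(real m * t / T) * (T / real m) < (of_int (grid_index T m t) + 1) * (T / real m)"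
    using d by (intro mult_right_mono mult_strict_right_mono; simp)+
  then show "grid_point T m t \<le> t" "t < grid_point T m t + T / real m"
    using assms by (auto simp: grid_point_def algebra_simps)
qed

lemma grid_index_range:
  assumes "0 < T" "0 < m" "t \<in> {0<..<T}"
  shows "0 \<le> grid_index T m t" "grid_index T m t < int m"
proof -
  show "0 \<le> grid_index T m t" using assms by (simp add: grid_index_def)
  have "real m * t / T < real m" using assms by (simp add: field_simps)
  then show "grid_index T m t < int m" unfolding grid_index_def by linarith
qed

lemma grid_point_in_interval:
  assumes "0 < T" "0 < m" "t \<in> {0<..<T}"
  shows "grid_point T m t \<in> {0..T}"
proof -
  have "0 \<le> grid_point T m t" using grid_index_range[OF assms] assms by (simp add: grid_point_def)
  moreover have "grid_point T m t \<le> t" using grid_point_bounds assms by auto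
  ultimately show ?thesis using assms by auto
qed

lemma abs_diff_less_mesh_if_same_cell:
  assumes "0 < T" "0 < m" "grid_index T m s = grid_index T m t"
  shows "\<bar>t - s\<bar> < T / real m"
  using grid_point_bounds[OF assms(1,2), of s] grid_point_bounds[OF assms(1,2), of t] assms(3)
  by (auto simp: grid_point_def)

text \<open>A point outside the cell of \<open>s\<close> lies beyond one of the two end points of that cell; this is what
  bounds \<open>|t - s|\<close> from below by a quantity that depends on \<open>s\<close> alone.\<close>

lemma grid_point_separates_cells:
  assumes "0 < T" "0 < m" "grid_index T m s \<noteq> grid_index T m t"
  shows "t < grid_point T m s \<or> grid_point T m s + T / real m \<le> t"
proof -
  have d: "0 < T / real m" using assms by simp
  from assms(3) consider "grid_index T m t + 1 \<le> grid_index T m s"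
    | "grid_index T m s + 1 \<le> grid_index T m t" by linarith
  then show ?thesis
  proof cases
    case 1
    then have "(of_int (grid_index T m t) + 1) * (T / real m) \<le> of_int (grid_index T m s) * (T / real m)"
      using d by (intro mult_right_mono) linarith+
    then have "grid_point T m t + T / real m \<le> grid_point T m s"
      unfolding grid_point_def by (simp only: distrib_right mult_1)
    then show ?thesis using grid_point_bounds[OF assms(1,2), of t] by linarith
  next
    case 2
    then have "(of_int (grid_index T m s) + 1) * (T / real m) \<le> of_int (grid_index T m t) * (T / real m)"
      using d by (intro mult_right_mono) linarith+
    then have "grid_point T m s + T / real m \<le> grid_point T m t"
      unfolding grid_point_def by (simp only: distrib_right mult_1)
    then show ?thesis using grid_point_bounds[OF assms(1,2), of t] by linarith
  qed
qed

section \<open>Singular double integrals over a grid\<close>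

text \<open>Up to a factor \<open>2\<close>, this is the power \<open>-b\<close> of the distance of \<open>s\<close> to the boundary of its cell.
  The sum replaces the maximum because it can be integrated term by term. At a grid point the first
  term is \<open>0\<close> by the convention \<open>0 powr x = 0\<close>, which is why grid points are excluded below.\<close>

definition cell_weight :: "real \<Rightarrow> nat \<Rightarrow> real \<Rightarrow> real \<Rightarrow> real" where
  "cell_weight T m b s = \<bar>s - grid_point T m s\<bar> powr - b + \<bar>s - (grid_point T m s + T / real m)\<bar> powr - b"

lemma borel_measurable_cell_weight [measurable]: "cell_weight T m b \<in> borel_measurable borel"
  unfolding cell_weight_def[abs_def] by measurable

lemma abs_diff_powr_le_cell_weight:
  assumes "0 < T" "0 < m" "0 < b" "grid_index T m s \<noteq> grid_index T m t" "s \<noteq> grid_point T m s"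
  shows "\<bar>t - s\<bar> powr - b \<le> cell_weight T m b s"
proof -
  note B = grid_point_bounds[OF assms(1,2), of s]
  have anti: "y powr - b \<le> x powr - b" if "0 < x" "x \<le> y" for x y :: real
    using that assms(3) by (simp add: powr_mono2')
  from grid_point_separates_cells[OF assms(1,2,4)] show ?thesis
  proof
    assume "t < grid_point T m s"
    then have "\<bar>t - s\<bar> powr - b \<le> \<bar>s - grid_point T m s\<bar> powr - b"
      using B assms(5) by (intro anti) auto
    then show ?thesis unfolding cell_weight_def by (smt (verit) powr_ge_zero)
  next
    assume "grid_point T m s + T / real m \<le> t"
    then have "\<bar>t - s\<bar> powr - b \<le> \<bar>s - (grid_point T m s + T / real m)\<bar> powr - b"
      using B by (intro anti) auto
    then show ?thesis unfolding cell_weight_def by (smt (verit) powr_ge_zero)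
  qed
qed

text \<open>Each of the \<open>m\<close> cells contributes two singularities, one at either end, each integrated over a
  neighbourhood whose radius is the mesh.\<close>

lemma nn_integral_cell_weight_le:
  assumes "0 < T" "0 < m" "0 < b" "b < 1"
  shows "(\<integral>\<^sup>+s. ennreal (cell_weight T m b s) \<partial>time_measure T)
    \<le> ennreal (real m * (4 * (T / real m) powr (1 - b) / (1 - b)))"
proof -
  define d where "d = T / real m"
  have d: "0 < d" using assms by (simp add: d_def)
  define q where "q = 2 * d powr (1 - b) / (1 - b)"
  have q: "0 \<le> q" using assms by (simp add: q_def)
  let ?k = "\<lambda>c s. ennreal (\<bar>s - c\<bar> powr - b) * indicator {c - d..c + d} s"
  let ?c = "\<lambda>i. real i * d"
  have "(\<integral>\<^sup>+s. ennreal (cell_weight T m b s) \<partial>time_measure T)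
    = (\<integral>\<^sup>+s\<in>{0<..<T}. ennreal (cell_weight T m b s) \<partial>lborel)"
    by (rule nn_integral_lebesgue_on) auto
  also have "\<dots> \<le> (\<integral>\<^sup>+s. (\<Sum>i<m. ?k (?c i) s + ?k (?c i + d) s) \<partial>lborel)"
  proof (rule nn_integral_mono)
    fix s :: real
    show "ennreal (cell_weight T m b s) * indicator {0<..<T} s
      \<le> (\<Sum>i<m. ?k (?c i) s + ?k (?c i + d) s)"
    proof (cases "s \<in> {0<..<T}")
      case True
      define i where "i = nat (grid_index T m s)"
      have i: "i < m" "grid_point T m s = ?c i"
        using grid_index_range[OF assms(1,2) True] by (auto simp: i_def grid_point_def d_def)
      have "ennreal (cell_weight T m b s) = ?k (?c i) s + ?k (?c i + d) s"
        using grid_point_bounds[OF assms(1,2), of s] i(2)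
        by (simp add: cell_weight_def d_def[symmetric] indicator_def)
      also have "\<dots> \<le> (\<Sum>i<m. ?k (?c i) s + ?k (?c i + d) s)"
        by (rule member_le_sum) (use i(1) in auto)
      finally show ?thesis using True by simp
    qed simp
  qed
  also have "\<dots> = (\<Sum>i<m. (\<integral>\<^sup>+s. ?k (?c i) s \<partial>lborel) + (\<integral>\<^sup>+s. ?k (?c i + d) s \<partial>lborel))"
    by (subst nn_integral_sum) (auto intro!: sum.cong nn_integral_add)
  also have "\<dots> \<le> (\<Sum>i<m. ennreal q + ennreal q)"
    unfolding q_def using d assms by (intro sum_mono add_mono nn_integral_abs_powr_le) auto
  also have "\<dots> = ennreal (real m * (2 * q))"
    using q by (simp add: ennreal_plus[symmetric] ennreal_mult' ennreal_of_nat_eq_real_of_nat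
        del: ennreal_plus)
  finally show ?thesis by (simp add: q_def d_def)
qed

text \<open>The first factor bounds the integral of \<open>|t - s|\<^bsup>-b\<^esup>\<close> over \<open>t\<close>. In the second, \<open>T\<close> is the length of
  the outer integration for pairs in the same cell, and \<open>4 / (1 - b)\<close> comes from the cell weight.\<close>

definition grid_constant :: "real \<Rightarrow> real \<Rightarrow> real" where
  "grid_constant T b = 2 * T powr (1 - b) / (1 - b) * (T + 4 / (1 - b))"

text \<open>The key estimate. The kernel exponent \<open>2 b\<close> exceeds \<open>1\<close> in general, so half of the singularity has
  to be absorbed: within a cell by the factor \<open>|t - s|\<close> of the bound on \<open>g\<close>, which trades
  \<open>|t - s|\<^bsup>1 - b\<^esup>\<close> for a power of the mesh, and across cells by the weight of the cell of \<open>s\<close>.\<close>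

lemma double_integral_grid_bound:
  fixes g :: "real \<Rightarrow> real \<Rightarrow> ennreal"
  assumes T: "0 < T" and m: "0 < m" and b: "1 / 2 \<le> b" "b < 1" and AB: "0 \<le> A" "0 \<le> B"
    and same: "\<And>s t. s \<in> {0<..<T} \<Longrightarrow> t \<in> {0<..<T} \<Longrightarrow> grid_index T m s = grid_index T m t \<Longrightarrow>
      g s t \<le> ennreal (A * \<bar>t - s\<bar>)"
    and other: "\<And>s t. s \<in> {0<..<T} \<Longrightarrow> t \<in> {0<..<T} \<Longrightarrow> grid_index T m s \<noteq> grid_index T m t \<Longrightarrow>
      g s t \<le> ennreal B"
  shows "(\<integral>\<^sup>+s. (\<integral>\<^sup>+t. g s t * ennreal (\<bar>t - s\<bar> powr - (2 * b)) \<partial>time_measure T)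
      \<partial>time_measure T)
    \<le> ennreal ((A + real m * B) * (T / real m) powr (1 - b) * grid_constant T b)"
proof -
  let ?L = "time_measure T"
  define d where "d = T / real m"
  have d: "0 < d" using T m by (simp add: d_def)
  define q where "q = 2 * T powr (1 - b) / (1 - b)"
  have q: "0 \<le> q" using b by (simp add: q_def)
  define r where "r = d powr (1 - b)"
  have r: "0 \<le> r" by (simp add: r_def)
  have b0: "0 < b" using b by simp
  define w where "w s = A * r + B * cell_weight T m b s" for s
  have cw: "0 \<le> cell_weight T m b s" for s by (simp add: cell_weight_def)
  have w0: "0 \<le> w s" for s using AB r cw by (simp add: w_def)
  have [measurable]: "w \<in> borel_measurable borel" unfolding w_def[abs_def] by measurable
  have pt: "g s t * ennreal (\<bar>t - s\<bar> powr - (2 * b)) \<le> ennreal (w s * \<bar>t - s\<bar> powr - b)"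
    if s: "s \<in> {0<..<T}" "s \<noteq> grid_point T m s" and t: "t \<in> {0<..<T}" for s t
  proof (cases "t = s")
    case False
    then have ts: "0 < \<bar>t - s\<bar>" by simp
    have split: "\<bar>t - s\<bar> powr - (2 * b) = \<bar>t - s\<bar> powr - b * \<bar>t - s\<bar> powr - b"
      by (simp add: powr_add[symmetric])
    show ?thesis
    proof (cases "grid_index T m s = grid_index T m t")
      case True
      have "A * \<bar>t - s\<bar> * \<bar>t - s\<bar> powr - (2 * b) = A * (\<bar>t - s\<bar> powr (1 - b) * \<bar>t - s\<bar> powr - b)"
        using ts by (simp add: powr_mult_base powr_add[symmetric] mult.assoc)
      also have "\<dots> \<le> A * (r * \<bar>t - s\<bar> powr - b)"
        using abs_diff_less_mesh_if_same_cell[OF T m True] AB b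
        by (intro mult_left_mono mult_right_mono) (auto simp: r_def d_def intro!: powr_mono2)
      also have "\<dots> \<le> w s * \<bar>t - s\<bar> powr - b"
        using AB cw[of s] by (simp add: w_def distrib_right mult.assoc)
      finally have le: "A * \<bar>t - s\<bar> * \<bar>t - s\<bar> powr - (2 * b) \<le> w s * \<bar>t - s\<bar> powr - b" .
      have "g s t * ennreal (\<bar>t - s\<bar> powr - (2 * b))
        \<le> ennreal (A * \<bar>t - s\<bar>) * ennreal (\<bar>t - s\<bar> powr - (2 * b))"
        using same[OF s(1) t True] by (intro mult_right_mono) auto
      also have "\<dots> = ennreal (A * \<bar>t - s\<bar> * \<bar>t - s\<bar> powr - (2 * b))"
        using AB by (simp add: ennreal_mult')
      finally show ?thesis using le by (meson ennreal_leI order_trans)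
    next
      case False
      have "B * \<bar>t - s\<bar> powr - (2 * b) \<le> B * cell_weight T m b s * \<bar>t - s\<bar> powr - b"
        unfolding split mult.assoc using abs_diff_powr_le_cell_weight[OF T m b0 False s(2)] AB
        by (intro mult_left_mono mult_right_mono) auto
      also have "\<dots> \<le> w s * \<bar>t - s\<bar> powr - b"
        using AB r by (simp add: w_def distrib_right)
      finally have le: "B * \<bar>t - s\<bar> powr - (2 * b) \<le> w s * \<bar>t - s\<bar> powr - b" .
      have "g s t * ennreal (\<bar>t - s\<bar> powr - (2 * b)) \<le> ennreal B * ennreal (\<bar>t - s\<bar> powr - (2 * b))"
        using other[OF s(1) t False] by (intro mult_right_mono) auto
      also have "\<dots> = ennreal (B * \<bar>t - s\<bar> powr - (2 * b))"
        using AB by (simp add: ennreal_mult')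
      finally show ?thesis using le by (meson ennreal_leI order_trans)
    qed
  qed simp
  have inner: "(\<integral>\<^sup>+t. g s t * ennreal (\<bar>t - s\<bar> powr - (2 * b)) \<partial>?L) \<le> ennreal (w s) * ennreal q"
    if s: "s \<in> {0<..<T}" "s \<noteq> grid_point T m s" for s
  proof -
    have "(\<integral>\<^sup>+t. g s t * ennreal (\<bar>t - s\<bar> powr - (2 * b)) \<partial>?L)
      \<le> (\<integral>\<^sup>+t. ennreal (w s) * ennreal (\<bar>t - s\<bar> powr - b) \<partial>?L)"
      using pt[OF s] w0 by (intro nn_integral_mono) (auto simp: ennreal_mult')
    also have "\<dots> = ennreal (w s) * (\<integral>\<^sup>+t. ennreal (\<bar>t - s\<bar> powr - b) \<partial>?L)"
      by (rule nn_integral_cmult)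
         (auto intro!: measurable_restrict_space1 measurable_completion)
    also have "\<dots> \<le> ennreal (w s) * ennreal q"
      unfolding q_def using s T b by (intro mult_left_mono nn_integral_abs_powr_le_interval) auto
    finally show ?thesis .
  qed
  (* Grid points, where the weight fails to dominate, form a null set. *)
  have nongrid: "AE s in ?L. s \<noteq> grid_point T m s"
  proof -
    have "countable (range (\<lambda>i::int. of_int i * (T / real m)))" by auto
    then have "AE s in lborel. s \<notin> range (\<lambda>i::int. of_int i * (T / real m))"
      by (intro AE_not_in countable_imp_null_set_lborel)
    then have "AE s in lebesgue. s \<notin> range (\<lambda>i::int. of_int i * (T / real m))"
      by (rule AE_completion)
    then have "AE s in ?L. s \<notin> range (\<lambda>i::int. of_int i * (T / real m))"
      by (subst AE_restrict_space_iff) auto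
    then show ?thesis
      by eventually_elim (auto simp: grid_point_def)
  qed
  have collect: "(ennreal x + ennreal B * ennreal y) * ennreal q = ennreal ((x + B * y) * q)"
    if "0 \<le> x" "0 \<le> y" for x y
    using that AB q by (simp add: ennreal_mult ennreal_plus)
  have "(\<integral>\<^sup>+s. (\<integral>\<^sup>+t. g s t * ennreal (\<bar>t - s\<bar> powr - (2 * b)) \<partial>?L) \<partial>?L)
    \<le> (\<integral>\<^sup>+s. ennreal (w s) * ennreal q \<partial>?L)"
  proof (rule nn_integral_mono_AE)
    show "AE s in ?L. (\<integral>\<^sup>+t. g s t * ennreal (\<bar>t - s\<bar> powr - (2 * b)) \<partial>?L)
      \<le> ennreal (w s) * ennreal q"
      using nongrid by (rule AE_mp) (rule AE_I2, auto intro!: inner)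
  qed
  also have "\<dots> = (\<integral>\<^sup>+s. ennreal (w s) \<partial>?L) * ennreal q"
    by (rule nn_integral_multc) (auto intro!: measurable_restrict_space1 measurable_completion)
  also have "(\<integral>\<^sup>+s. ennreal (w s) \<partial>?L)
    = (\<integral>\<^sup>+s. ennreal (A * r) \<partial>?L) + (\<integral>\<^sup>+s. ennreal B * ennreal (cell_weight T m b s) \<partial>?L)"
    using AB r cw unfolding w_def
    by (subst nn_integral_add[symmetric])
       (auto intro!: measurable_restrict_space1 measurable_completion simp: ennreal_mult')
  also have "(\<integral>\<^sup>+s. ennreal (A * r) \<partial>?L) = ennreal (A * r * T)"
    using T AB r by (simp add: emeasure_restrict_space ennreal_mult')
  also have "(\<integral>\<^sup>+s. ennreal B * ennreal (cell_weight T m b s) \<partial>?L)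
    = ennreal B * (\<integral>\<^sup>+s. ennreal (cell_weight T m b s) \<partial>?L)"
    by (rule nn_integral_cmult) (auto intro!: measurable_restrict_space1 measurable_completion)
  also have "(ennreal (A * r * T) + ennreal B * (\<integral>\<^sup>+s. ennreal (cell_weight T m b s) \<partial>?L)) * ennreal q
    \<le> (ennreal (A * r * T) + ennreal B * ennreal (real m * (4 * r / (1 - b)))) * ennreal q"
    unfolding r_def d_def using nn_integral_cell_weight_le[OF T m b0 b(2)]
    by (intro mult_right_mono add_left_mono mult_left_mono) auto
  also have "\<dots> = ennreal ((A * r * T + B * (real m * (4 * r / (1 - b)))) * q)"
    using AB r T b q collect[of "A * r * T" "real m * (4 * r / (1 - b))"] by simp
  also have "\<dots> \<le> ennreal ((A + real m * B) * r * (q * (T + 4 / (1 - b))))"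
  proof (rule ennreal_leI)
    define z where "z = 4 / (1 - b)"
    have z: "0 \<le> z" using b by (simp add: z_def)
    have "(A * r * T + B * (real m * (r * z))) * q \<le> (A + real m * B) * r * (q * (T + z))"
      using AB r T q z m by (simp add: algebra_simps)
    then show "(A * r * T + B * (real m * (4 * r / (1 - b)))) * q
      \<le> (A + real m * B) * r * (q * (T + 4 / (1 - b)))"
      by (simp add: z_def mult.commute)
  qed
  finally show ?thesis by (simp add: r_def q_def d_def grid_constant_def)
qed

section \<open>Moments of Poisson increments\<close>

lemma power_le_fact_mult_exp: "real n ^ k \<le> fact k * exp (real n)"
proof -
  have "real n ^ k /\<^sub>R fact k = (\<Sum>i\<in>{k}. real n ^ i /\<^sub>R fact i)" by simp
  also have "\<dots> \<le> exp (real n)"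
    unfolding exp_def by (intro sum_le_suminf summable_exp_generic) auto
  finally show ?thesis by (simp add: field_simps)
qed

lemma powr_le_power_ceiling: "real n powr p \<le> real n ^ nat \<lceil>p\<rceil>"
proof (cases "n = 0")
  case False
  have "real n powr p \<le> real n powr real (nat \<lceil>p\<rceil>)"
    using False by (intro powr_mono) linarith+
  then show ?thesis using False by (simp add: powr_realpow)
qed simp

text \<open>The term \<open>n = 0\<close> vanishes and every other term contains \<open>\<mu>\<^sup>n \<le> \<mu> \<Lambda>\<^bsup>n - 1\<^esup>\<close>. The remaining series
  converges since \<open>n\<^sup>p\<close> grows at most like a multiple of \<open>e\<^sup>n\<close>, which the exponential series in
  \<open>e \<Lambda>\<close> absorbs. One is added to the sum only to make the constant positive.\<close>

lemma poisson_moment_le_linear: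
  fixes \<Lambda> p :: real
  assumes "0 < \<Lambda>"
  shows "\<exists>C>0. \<forall>\<mu>. 0 \<le> \<mu> \<and> \<mu> \<le> \<Lambda> \<longrightarrow>
    (\<Sum>n. ennreal (real n powr p * (\<mu> ^ n / fact n * exp (- \<mu>)))) \<le> ennreal (C * \<mu>)"
proof -
  define c where "c n = real n powr p * (\<Lambda> ^ (n - 1) / fact n)" for n
  have c0: "0 \<le> c n" for n using assms by (simp add: c_def)
  have "summable c"
  proof (rule summable_comparison_test')
    let ?k = "nat \<lceil>p\<rceil>"
    show "summable (\<lambda>n. fact ?k / \<Lambda> * ((exp 1 * \<Lambda>) ^ n /\<^sub>R fact n))"
      by (intro summable_mult summable_exp_generic)
    show "norm (c n) \<le> fact ?k / \<Lambda> * ((exp 1 * \<Lambda>) ^ n /\<^sub>R fact n)" if "n \<ge> 1" for n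
    proof -
      have "real n powr p \<le> fact ?k * exp 1 ^ n"
        using powr_le_power_ceiling[of n p] power_le_fact_mult_exp[of n ?k]
        by (simp add: exp_of_nat_mult[symmetric])
      then have "c n \<le> fact ?k * exp 1 ^ n * (\<Lambda> ^ (n - 1) / fact n)"
        unfolding c_def using assms by (intro mult_right_mono) auto
      also have "\<dots> = fact ?k / \<Lambda> * ((exp 1 * \<Lambda>) ^ n /\<^sub>R fact n)"
        using assms that by (cases n) (auto simp: field_simps power_mult_distrib)
      finally show ?thesis using c0 by simp
    qed
  qed
  have bound: "(\<Sum>n. ennreal (real n powr p * (\<mu> ^ n / fact n * exp (- \<mu>)))) \<le> ennreal ((suminf c + 1) * \<mu>)"
    if \<mu>: "0 \<le> \<mu>" "\<mu> \<le> \<Lambda>" for \<mu>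
  proof -
    have le: "real n powr p * (\<mu> ^ n / fact n * exp (- \<mu>)) \<le> c n * \<mu>" for n
    proof (cases n)
      case (Suc k)
      have "\<mu> ^ k * exp (- \<mu>) \<le> \<Lambda> ^ k * 1" using \<mu> by (intro mult_mono power_mono) auto
      then have "\<mu> ^ n * exp (- \<mu>) \<le> \<Lambda> ^ (n - 1) * \<mu>"
        using \<mu> mult_left_mono[of "\<mu> ^ k * exp (- \<mu>)" "\<Lambda> ^ k" \<mu>] Suc by (simp add: algebra_simps)
      then have "real n powr p / fact n * (\<mu> ^ n * exp (- \<mu>)) \<le> real n powr p / fact n * (\<Lambda> ^ (n - 1) * \<mu>)"
        by (intro mult_left_mono) auto
      then show ?thesis by (simp add: c_def)
    qed (simp add: c_def)
    have "(\<Sum>n. ennreal (real n powr p * (\<mu> ^ n / fact n * exp (- \<mu>)))) \<le> (\<Sum>n. ennreal (c n * \<mu>))"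
      using le by (intro suminf_le ennreal_leI) auto
    also have "\<dots> = ennreal (suminf c * \<mu>)"
      using c0 \<mu> \<open>summable c\<close> by (subst suminf_ennreal2) (auto simp: suminf_mult2 summable_mult2)
    also have "\<dots> \<le> ennreal ((suminf c + 1) * \<mu>)" using \<mu> by (intro ennreal_leI) (simp add: algebra_simps)
    finally show ?thesis .
  qed
  have "0 < suminf c + 1" using suminf_nonneg[OF \<open>summable c\<close> c0] by simp
  then show ?thesis using bound by blast
qed

context
  fixes M :: "'w measure" and T a :: real and N :: "real \<Rightarrow> 'w \<Rightarrow> nat"
  assumes prob: "prob_space M" and poisson: "poisson_process M T a N"
begin

interpretation prob_space M by (rule prob)

lemma poisson_process_measurable: "t \<in> {0..T} \<Longrightarrow> N t \<in> measurable M (count_space UNIV)"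
  using poisson by (simp add: poisson_process_def)

lemma poisson_process_increment_prob:
  assumes "0 \<le> s" "s \<le> t" "t \<le> T"
  shows "prob {\<omega> \<in> space M. int (N t \<omega>) - int (N s \<omega>) = int n}
    = (a * (t - s)) ^ n / fact n * exp (- (a * (t - s)))"
  using poisson assms unfolding poisson_process_def by blast

lemma increment_event_sets:
  assumes "0 \<le> s" "s \<le> t" "t \<le> T"
  shows "{\<omega> \<in> space M. int (N t \<omega>) - int (N s \<omega>) = int n} \<in> sets M"
proof -
  have [measurable]: "N s \<in> measurable M (count_space UNIV)" "N t \<in> measurable M (count_space UNIV)"
    using assms by (auto intro: poisson_process_measurable)
  show ?thesis by measurable
qed

text \<open>The law of the increment charges only natural numbers: its point masses there already sum to one.\<close>

lemma poisson_process_mono_AE: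
  assumes st: "0 \<le> s" "s \<le> t" "t \<le> T"
  shows "AE \<omega> in M. N s \<omega> \<le> N t \<omega>"
proof -
  let ?E = "\<lambda>n::nat. {\<omega> \<in> space M. int (N t \<omega>) - int (N s \<omega>) = int n}"
  let ?\<mu> = "a * (t - s)"
  note E = increment_event_sets[OF st]
  have "(\<lambda>n. prob (?E n)) sums prob (\<Union>n. ?E n)"
    using E by (intro finite_measure_UNION) (auto simp: disjoint_family_on_def)
  moreover have "(\<lambda>n. prob (?E n)) sums (exp ?\<mu> * exp (- ?\<mu>))"
    unfolding poisson_process_increment_prob[OF st]
    using sums_mult2[OF exp_converges[of ?\<mu>], of "exp (- ?\<mu>)"] by (simp add: field_simps)
  ultimately have "prob (\<Union>n. ?E n) = 1"
    by (simp add: sums_unique2 exp_add[symmetric])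
  then have "AE \<omega> in M. \<omega> \<in> (\<Union>n. ?E n)"
    using E by (subst (asm) prob_eq_1) auto
  then show ?thesis
  proof eventually_elim
    case (elim \<omega>)
    then obtain n where "int (N t \<omega>) - int (N s \<omega>) = int n" by blast
    then show ?case by linarith
  qed
qed

lemma poisson_process_increment_moment:
  assumes a: "0 < a" and T: "0 < T"
  shows "\<exists>C>0. \<forall>s\<in>{0..T}. \<forall>t\<in>{0..T}.
    (\<integral>\<^sup>+\<omega>. ennreal (\<bar>real (N t \<omega>) - real (N s \<omega>)\<bar> powr p) \<partial>M) \<le> ennreal (C * \<bar>t - s\<bar>)"
proof -
  obtain C where C: "0 < C" "\<And>\<mu>. 0 \<le> \<mu> \<Longrightarrow> \<mu> \<le> a * T \<Longrightarrow>
      (\<Sum>n. ennreal (real n powr p * (\<mu> ^ n / fact n * exp (- \<mu>)))) \<le> ennreal (C * \<mu>)"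
    using poisson_moment_le_linear[OF mult_pos_pos[OF a T], of p] by blast
  have ordered: "(\<integral>\<^sup>+\<omega>. ennreal (\<bar>real (N t \<omega>) - real (N s \<omega>)\<bar> powr p) \<partial>M) \<le> ennreal (C * (a * (t - s)))"
    if st: "0 \<le> s" "s \<le> t" "t \<le> T" for s t
  proof -
    let ?E = "\<lambda>n::nat. {\<omega> \<in> space M. int (N t \<omega>) - int (N s \<omega>) = int n}"
    let ?\<mu> = "a * (t - s)"
    note E = increment_event_sets[OF st]
    have "AE \<omega> in M. ennreal (\<bar>real (N t \<omega>) - real (N s \<omega>)\<bar> powr p)
      = (\<Sum>n. ennreal (real n powr p) * indicator (?E n) \<omega>)"
      using poisson_process_mono_AE[OF st] AE_space
    proof eventually_elim
      case (elim \<omega>)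
      let ?d = "N t \<omega> - N s \<omega>"
      have "(\<Sum>n. ennreal (real n powr p) * indicator (?E n) \<omega>)
        = (\<Sum>n\<in>{?d}. ennreal (real n powr p) * indicator (?E n) \<omega>)"
        using elim by (intro suminf_finite) (auto split: split_indicator)
      then show ?case using elim by (auto simp: of_nat_diff)
    qed
    then have "(\<integral>\<^sup>+\<omega>. ennreal (\<bar>real (N t \<omega>) - real (N s \<omega>)\<bar> powr p) \<partial>M)
      = (\<integral>\<^sup>+\<omega>. (\<Sum>n. ennreal (real n powr p) * indicator (?E n) \<omega>) \<partial>M)"
      by (rule nn_integral_cong_AE)
    also have "\<dots> = (\<Sum>n. ennreal (real n powr p) * emeasure M (?E n))"
      using E by (subst nn_integral_suminf) (auto simp: nn_integral_cmult_indicator)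
    also have "\<dots> = (\<Sum>n. ennreal (real n powr p * (?\<mu> ^ n / fact n * exp (- ?\<mu>))))"
      using a st unfolding emeasure_eq_measure poisson_process_increment_prob[OF st]
      by (simp add: ennreal_mult'[symmetric])
    also have "\<dots> \<le> ennreal (C * ?\<mu>)" using a st by (intro C(2)) auto
    finally show ?thesis .
  qed
  have "(\<integral>\<^sup>+\<omega>. ennreal (\<bar>real (N t \<omega>) - real (N s \<omega>)\<bar> powr p) \<partial>M) \<le> ennreal (C * a * \<bar>t - s\<bar>)"
    if "s \<in> {0..T}" "t \<in> {0..T}" for s t
    using that ordered[of s t] ordered[of t s]
    by (cases "s \<le> t") (auto simp: abs_minus_commute mult.assoc)
  then show ?thesis using C(1) a by (intro exI[of _ "C * a"]) auto
qed

end

section \<open>Joint measurability of right-continuous processes\<close>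

text \<open>Time is replaced by the smallest point of \<open>\<int> / (m + 1)\<close> strictly to its right, cut off at \<open>t\<close>. This
  takes countably many values, so the substituted process is measurable, and it tends to the
  original time strictly from above, except at \<open>t\<close> itself, where the cut-off makes it exact.\<close>

lemma right_continuous_jointly_measurable:
  fixes X :: "real \<Rightarrow> 'w \<Rightarrow> real"
  assumes t: "0 \<le> t"
    and X: "\<And>s. s \<in> {0..t} \<Longrightarrow> X s \<in> borel_measurable A"
    and right: "\<And>s \<omega>. s \<in> {0..<t} \<Longrightarrow> \<omega> \<in> space A \<Longrightarrow> ((\<lambda>r. X r \<omega>) \<longlongrightarrow> X s \<omega>) (at_right s)"
  shows "(\<lambda>(s, \<omega>). X s \<omega>) \<in> borel_measurable (restrict_space borel {0..t} \<Otimes>\<^sub>M A)"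
proof (rule borel_measurable_LIMSEQ_metric)
  (* The lower cut-off at 0 is inactive; it lets i range over all integers. *)
  define \<rho> where "\<rho> m i = min t (max 0 ((of_int i + 1) / real (Suc m)))" for m and i :: int
  define k where "k m s = \<lfloor>real (Suc m) * s\<rfloor>" for m and s :: real
  show "(\<lambda>(s, \<omega>). X (\<rho> m (k m s)) \<omega>) \<in> borel_measurable (restrict_space borel {0..t} \<Otimes>\<^sub>M A)" for m
  proof -
    have "(\<lambda>z. X (\<rho> m (k m (fst z))) (snd z)) \<in> borel_measurable (restrict_space borel {0..t} \<Otimes>\<^sub>M A)"
    proof (rule measurable_compose_countable)
      show "(\<lambda>z. X (\<rho> m i) (snd z)) \<in> borel_measurable (restrict_space borel {0..t} \<Otimes>\<^sub>M A)" for i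
        using t by (intro measurable_compose[OF measurable_snd X]) (auto simp: \<rho>_def)
      have [measurable]: "(\<lambda>s. s) \<in> restrict_space borel {0..t} \<rightarrow>\<^sub>M borel"
        by (intro measurable_restrict_space1) auto
      have "(\<lambda>s. k m s) \<in> restrict_space borel {0..t} \<rightarrow>\<^sub>M count_space UNIV"
        unfolding k_def by measurable
      then show "(\<lambda>z. k m (fst z)) \<in> restrict_space borel {0..t} \<Otimes>\<^sub>M A \<rightarrow>\<^sub>M count_space UNIV"
        by measurable
    qed
    then show ?thesis by (simp add: case_prod_beta)
  qed
  fix z assume z: "z \<in> space (restrict_space borel {0..t} \<Otimes>\<^sub>M A)"
  obtain s \<omega> where z_eq: "z = (s, \<omega>)" by (cases z)
  have s: "s \<in> {0..t}" and \<omega>: "\<omega> \<in> space A"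
    using z by (auto simp: z_eq space_pair_measure space_restrict_space)
  have \<rho>_eq: "\<rho> m (k m s) = min t ((of_int (k m s) + 1) / real (Suc m))" for m
    using s by (simp add: \<rho>_def k_def)
  have above: "s < (of_int (k m s) + 1) / real (Suc m)" for m
    using floor_correct[of "real (Suc m) * s"] by (simp add: k_def field_simps)
  have below: "(of_int (k m s) + 1) / real (Suc m) \<le> s + 1 / real (Suc m)" for m
  proof -
    have "(of_int (k m s) + 1) / real (Suc m) \<le> (real (Suc m) * s + 1) / real (Suc m)"
      unfolding k_def by (intro divide_right_mono) linarith+
    then show ?thesis by (simp add: add_divide_distrib)
  qed
  show "(\<lambda>m. case z of (s, \<omega>) \<Rightarrow> X (\<rho> m (k m s)) \<omega>) \<longlonglongrightarrow> (case z of (s, \<omega>) \<Rightarrow> X s \<omega>)"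
  proof (cases "s = t")
    case True
    then have "\<rho> m (k m s) = s" for m using above[of m] unfolding \<rho>_eq by simp
    then show ?thesis by (simp add: z_eq)
  next
    case False
    then have st: "s < t" using s by simp
    have gt: "s < \<rho> m (k m s)" for m using above[of m] st unfolding \<rho>_eq by simp
    have "(\<lambda>m. \<rho> m (k m s)) \<longlonglongrightarrow> s"
    proof (rule real_tendsto_sandwich)
      show "\<forall>\<^sub>F m in sequentially. s \<le> \<rho> m (k m s)" using gt by (simp add: less_imp_le)
      show "\<forall>\<^sub>F m in sequentially. \<rho> m (k m s) \<le> s + 1 / real (Suc m)"
        using below unfolding \<rho>_eq by (simp add: min.coboundedI2)
      show "(\<lambda>m. s + 1 / real (Suc m)) \<longlonglongrightarrow> s"
        using tendsto_add[OF tendsto_const[of s] LIMSEQ_inverse_real_of_nat]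
        by (simp add: inverse_eq_divide)
    qed simp
    then have "filterlim (\<lambda>m. \<rho> m (k m s)) (at_right s) sequentially"
      using gt by (auto simp: filterlim_at less_imp_neq[symmetric] intro!: always_eventually)
    then have "(\<lambda>m. X (\<rho> m (k m s)) \<omega>) \<longlonglongrightarrow> X s \<omega>"
      using right[of s \<omega>] s st \<omega> by (auto intro: filterlim_compose)
    then show ?thesis by (simp add: z_eq)
  qed
qed

section \<open>The expected energy of a jointly measurable process\<close>

lemma measurable_lebesgue_on_borel:
  assumes "f \<in> measurable borel A"
  shows "f \<in> measurable (lebesgue_on S) A"
  using assms by (intro measurable_restrict_space1 measurable_completion) simp

lemma divide_powr_ennreal:
  fixes x y c :: real
  assumes "0 \<le> x"
  shows "ennreal (x / y powr c) = ennreal x * ennreal (y powr - c)"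
  using assms by (simp add: ennreal_mult''[symmetric] powr_minus divide_inverse)

context
  fixes M :: "'w measure" and T \<sigma> p :: real and X :: "real \<Rightarrow> 'w \<Rightarrow> real"
  assumes M: "sigma_finite_measure M"
    and X: "(\<lambda>(t, \<omega>). X t \<omega>) \<in> borel_measurable (lebesgue_on {0<..<T} \<Otimes>\<^sub>M M)"
begin

interpretation M: sigma_finite_measure M by (rule M)
interpretation L: finite_measure "time_measure T" by (rule finite_measure_lebesgue_on) simp
interpretation LM: pair_sigma_finite "time_measure T" M ..

lemma jointly_measurable_compose:
  assumes "f \<in> measurable A (time_measure T)" "g \<in> measurable A M"
  shows "(\<lambda>w. X (f w) (g w)) \<in> borel_measurable A"
  using measurable_compose[OF measurable_Pair[OF assms] X] by simp

lemma sobolev_quotient_measurable: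
  assumes "f \<in> measurable A (time_measure T)" "g \<in> measurable A (time_measure T)" "h \<in> measurable A M"
  shows "(\<lambda>w. ennreal (\<bar>X (g w) (h w) - X (f w) (h w)\<bar> powr p / \<bar>g w - f w\<bar> powr (1 + \<sigma> * p)))
    \<in> borel_measurable A"
proof -
  have id: "(\<lambda>t::real. t) \<in> borel_measurable (time_measure T)" by (rule measurable_lebesgue_on_borel) simp
  have [measurable]: "f \<in> borel_measurable A" "g \<in> borel_measurable A"
    using measurable_compose[OF assms(1) id] measurable_compose[OF assms(2) id] by auto
  have [measurable]: "(\<lambda>w. X (g w) (h w)) \<in> borel_measurable A" "(\<lambda>w. X (f w) (h w)) \<in> borel_measurable A"
    using assms by (auto intro: jointly_measurable_compose)
  show ?thesis by measurable
qed

lemma sobolev_moment_measurable: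
  assumes "f \<in> measurable A (time_measure T)" "h \<in> measurable A M"
  shows "(\<lambda>w. ennreal (\<bar>X (f w) (h w)\<bar> powr p)) \<in> borel_measurable A"
proof -
  have [measurable]: "(\<lambda>w. X (f w) (h w)) \<in> borel_measurable A"
    using assms by (auto intro: jointly_measurable_compose)
  show ?thesis by measurable
qed

lemma inner_sobolev_integral_measurable:
  assumes "f \<in> measurable A (time_measure T)" "h \<in> measurable A M"
  shows "(\<lambda>w. \<integral>\<^sup>+t. ennreal (\<bar>X t (h w) - X (f w) (h w)\<bar> powr p / \<bar>t - f w\<bar> powr (1 + \<sigma> * p)) \<partial>time_measure T)
    \<in> borel_measurable A"
proof (rule L.borel_measurable_nn_integral)
  have "(\<lambda>z. ennreal (\<bar>X (snd z) (h (fst z)) - X (f (fst z)) (h (fst z))\<bar> powr p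
      / \<bar>snd z - f (fst z)\<bar> powr (1 + \<sigma> * p))) \<in> borel_measurable (A \<Otimes>\<^sub>M time_measure T)"
    by (intro sobolev_quotient_measurable measurable_compose[OF measurable_fst] measurable_snd assms)
  then show "(\<lambda>(w, t). ennreal (\<bar>X t (h w) - X (f w) (h w)\<bar> powr p / \<bar>t - f w\<bar> powr (1 + \<sigma> * p)))
      \<in> borel_measurable (A \<Otimes>\<^sub>M time_measure T)"
    by (simp add: case_prod_beta)
qed

lemma path_moment_measurable:
  "(\<lambda>\<omega>. \<integral>\<^sup>+t. ennreal (\<bar>X t \<omega>\<bar> powr p) \<partial>time_measure T) \<in> borel_measurable M"
proof (rule L.borel_measurable_nn_integral)
  have "(\<lambda>z. ennreal (\<bar>X (snd z) (fst z)\<bar> powr p)) \<in> borel_measurable (M \<Otimes>\<^sub>M time_measure T)"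
    by (intro sobolev_moment_measurable measurable_fst measurable_snd)
  then show "(\<lambda>(\<omega>, t). ennreal (\<bar>X t \<omega>\<bar> powr p)) \<in> borel_measurable (M \<Otimes>\<^sub>M time_measure T)"
    by (simp add: case_prod_beta)
qed

lemma path_seminorm_measurable:
  "(\<lambda>\<omega>. \<integral>\<^sup>+s. (\<integral>\<^sup>+t. ennreal (\<bar>X t \<omega> - X s \<omega>\<bar> powr p / \<bar>t - s\<bar> powr (1 + \<sigma> * p))
      \<partial>time_measure T) \<partial>time_measure T) \<in> borel_measurable M"
proof (rule L.borel_measurable_nn_integral)
  have "(\<lambda>z. \<integral>\<^sup>+t. ennreal (\<bar>X t (fst z) - X (snd z) (fst z)\<bar> powr p / \<bar>t - snd z\<bar> powr (1 + \<sigma> * p))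
      \<partial>time_measure T) \<in> borel_measurable (M \<Otimes>\<^sub>M time_measure T)"
    by (intro inner_sobolev_integral_measurable measurable_fst measurable_snd)
  then show "(\<lambda>(\<omega>, s). \<integral>\<^sup>+t. ennreal (\<bar>X t \<omega> - X s \<omega>\<bar> powr p / \<bar>t - s\<bar> powr (1 + \<sigma> * p))
      \<partial>time_measure T) \<in> borel_measurable (M \<Otimes>\<^sub>M time_measure T)"
    by (simp add: case_prod_beta)
qed

lemma frac_sobolev_energy_measurable:
  "(\<lambda>\<omega>. frac_sobolev_energy T \<sigma> p (\<lambda>t. X t \<omega>)) \<in> borel_measurable M"
  unfolding frac_sobolev_energy_def
  by (intro borel_measurable_add path_moment_measurable path_seminorm_measurable)

text \<open>Tonelli, with the expectation moved inside both time integrals: afterwards only the moments of the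
  increments matter.\<close>

lemma expected_frac_sobolev_energy:
  "(\<integral>\<^sup>+\<omega>. frac_sobolev_energy T \<sigma> p (\<lambda>t. X t \<omega>) \<partial>M)
    = (\<integral>\<^sup>+t. (\<integral>\<^sup>+\<omega>. ennreal (\<bar>X t \<omega>\<bar> powr p) \<partial>M) \<partial>time_measure T)
    + (\<integral>\<^sup>+s. (\<integral>\<^sup>+t. (\<integral>\<^sup>+\<omega>. ennreal (\<bar>X t \<omega> - X s \<omega>\<bar> powr p) \<partial>M)
        * ennreal (\<bar>t - s\<bar> powr - (1 + \<sigma> * p)) \<partial>time_measure T) \<partial>time_measure T)"
proof -
  let ?f = "\<lambda>s t \<omega>. ennreal (\<bar>X t \<omega> - X s \<omega>\<bar> powr p / \<bar>t - s\<bar> powr (1 + \<sigma> * p))"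
  have m1: "(\<lambda>(t, \<omega>). ennreal (\<bar>X t \<omega>\<bar> powr p)) \<in> borel_measurable (time_measure T \<Otimes>\<^sub>M M)"
    using sobolev_moment_measurable[OF measurable_fst measurable_snd] by (simp add: case_prod_beta)
  have m2: "(\<lambda>(s, \<omega>). \<integral>\<^sup>+t. ?f s t \<omega> \<partial>time_measure T) \<in> borel_measurable (time_measure T \<Otimes>\<^sub>M M)"
    using inner_sobolev_integral_measurable[OF measurable_fst measurable_snd]
    by (simp add: case_prod_beta)
  have swap: "(\<integral>\<^sup>+\<omega>. (\<integral>\<^sup>+t. ?f s t \<omega> \<partial>time_measure T) \<partial>M)
      = (\<integral>\<^sup>+t. (\<integral>\<^sup>+\<omega>. ennreal (\<bar>X t \<omega> - X s \<omega>\<bar> powr p) \<partial>M) * ennreal (\<bar>t - s\<bar> powr - (1 + \<sigma> * p)) \<partial>time_measure T)"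
    if s: "s \<in> space (time_measure T)" for s
  proof -
    have m3: "(\<lambda>(t, \<omega>). ?f s t \<omega>) \<in> borel_measurable (time_measure T \<Otimes>\<^sub>M M)"
      using sobolev_quotient_measurable[OF measurable_const[OF s] measurable_fst measurable_snd]
      by (simp add: case_prod_beta)
    have "(\<integral>\<^sup>+\<omega>. (\<integral>\<^sup>+t. ?f s t \<omega> \<partial>time_measure T) \<partial>M) = (\<integral>\<^sup>+t. (\<integral>\<^sup>+\<omega>. ?f s t \<omega> \<partial>M) \<partial>time_measure T)"
      using LM.Fubini'[OF m3] .
    also have "\<dots> = (\<integral>\<^sup>+t. (\<integral>\<^sup>+\<omega>. ennreal (\<bar>X t \<omega> - X s \<omega>\<bar> powr p) \<partial>M)
        * ennreal (\<bar>t - s\<bar> powr - (1 + \<sigma> * p)) \<partial>time_measure T)"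
    proof (rule nn_integral_cong)
      fix t assume t: "t \<in> space (time_measure T)"
      have [measurable]: "X t \<in> borel_measurable M" "X s \<in> borel_measurable M"
        using jointly_measurable_compose[OF measurable_const[OF t] measurable_ident]
          jointly_measurable_compose[OF measurable_const[OF s] measurable_ident] by (auto simp: eta_contract_eq)
      show "(\<integral>\<^sup>+\<omega>. ?f s t \<omega> \<partial>M) = (\<integral>\<^sup>+\<omega>. ennreal (\<bar>X t \<omega> - X s \<omega>\<bar> powr p) \<partial>M)
        * ennreal (\<bar>t - s\<bar> powr - (1 + \<sigma> * p))"
        by (subst nn_integral_multc[symmetric]) (auto simp: divide_powr_ennreal)
    qed
    finally show ?thesis .
  qed
  have "(\<integral>\<^sup>+\<omega>. frac_sobolev_energy T \<sigma> p (\<lambda>t. X t \<omega>) \<partial>M)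
    = (\<integral>\<^sup>+\<omega>. (\<integral>\<^sup>+t. ennreal (\<bar>X t \<omega>\<bar> powr p) \<partial>time_measure T) \<partial>M) + (\<integral>\<^sup>+\<omega>. (\<integral>\<^sup>+s. (\<integral>\<^sup>+t. ?f s t \<omega> \<partial>time_measure T) \<partial>time_measure T) \<partial>M)"
    unfolding frac_sobolev_energy_def
    by (intro nn_integral_add path_moment_measurable path_seminorm_measurable)
  also have "(\<integral>\<^sup>+\<omega>. (\<integral>\<^sup>+t. ennreal (\<bar>X t \<omega>\<bar> powr p) \<partial>time_measure T) \<partial>M)
    = (\<integral>\<^sup>+t. (\<integral>\<^sup>+\<omega>. ennreal (\<bar>X t \<omega>\<bar> powr p) \<partial>M) \<partial>time_measure T)"
    using LM.Fubini'[OF m1] .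
  also have "(\<integral>\<^sup>+\<omega>. (\<integral>\<^sup>+s. (\<integral>\<^sup>+t. ?f s t \<omega> \<partial>time_measure T) \<partial>time_measure T) \<partial>M) = (\<integral>\<^sup>+s. (\<integral>\<^sup>+\<omega>. (\<integral>\<^sup>+t. ?f s t \<omega> \<partial>time_measure T) \<partial>M) \<partial>time_measure T)"
    using LM.Fubini'[OF m2] .
  also have "\<dots> = (\<integral>\<^sup>+s. (\<integral>\<^sup>+t. (\<integral>\<^sup>+\<omega>. ennreal (\<bar>X t \<omega> - X s \<omega>\<bar> powr p) \<partial>M)
        * ennreal (\<bar>t - s\<bar> powr - (1 + \<sigma> * p)) \<partial>time_measure T) \<partial>time_measure T)"
    by (rule nn_integral_cong) (rule swap)
  finally show ?thesis .
qed

end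

lemma expected_energy_grid_bound:
  fixes X :: "real \<Rightarrow> 'w \<Rightarrow> real" and \<sigma> p :: real
  defines "b \<equiv> (1 + \<sigma> * p) / 2"
  assumes M: "sigma_finite_measure M"
    and X: "(\<lambda>(t, \<omega>). X t \<omega>) \<in> borel_measurable (time_measure T \<Otimes>\<^sub>M M)"
    and T: "0 < T" and m: "0 < m" and \<sigma>p: "0 \<le> \<sigma> * p" "\<sigma> * p < 1"
    and AB: "0 \<le> A" "0 \<le> B" "0 \<le> D"
    and moment: "\<And>t. t \<in> {0<..<T} \<Longrightarrow> (\<integral>\<^sup>+\<omega>. ennreal (\<bar>X t \<omega>\<bar> powr p) \<partial>M) \<le> ennreal D"
    and same: "\<And>s t. s \<in> {0<..<T} \<Longrightarrow> t \<in> {0<..<T} \<Longrightarrow> grid_index T m s = grid_index T m t \<Longrightarrow>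
      (\<integral>\<^sup>+\<omega>. ennreal (\<bar>X t \<omega> - X s \<omega>\<bar> powr p) \<partial>M) \<le> ennreal (A * \<bar>t - s\<bar>)"
    and other: "\<And>s t. s \<in> {0<..<T} \<Longrightarrow> t \<in> {0<..<T} \<Longrightarrow> grid_index T m s \<noteq> grid_index T m t \<Longrightarrow>
      (\<integral>\<^sup>+\<omega>. ennreal (\<bar>X t \<omega> - X s \<omega>\<bar> powr p) \<partial>M) \<le> ennreal B"
  shows "(\<integral>\<^sup>+\<omega>. frac_sobolev_energy T \<sigma> p (\<lambda>t. X t \<omega>) \<partial>M)
    \<le> ennreal (D * T + (A + real m * B) * (T / real m) powr (1 - b) * grid_constant T b)"
proof -
  have b: "1 / 2 \<le> b" "b < 1" "2 * b = 1 + \<sigma> * p" using \<sigma>p by (auto simp: b_def)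
  have K: "0 \<le> grid_constant T b" using b T by (simp add: grid_constant_def)
  have "(\<integral>\<^sup>+t. (\<integral>\<^sup>+\<omega>. ennreal (\<bar>X t \<omega>\<bar> powr p) \<partial>M) \<partial>time_measure T) \<le> (\<integral>\<^sup>+t. ennreal D \<partial>time_measure T)"
    by (intro nn_integral_mono moment) auto
  also have "\<dots> = ennreal (D * T)"
    using T AB by (simp add: emeasure_restrict_space ennreal_mult)
  finally have 1: "(\<integral>\<^sup>+t. (\<integral>\<^sup>+\<omega>. ennreal (\<bar>X t \<omega>\<bar> powr p) \<partial>M) \<partial>time_measure T) \<le> ennreal (D * T)" .
  have 2: "(\<integral>\<^sup>+s. (\<integral>\<^sup>+t. (\<integral>\<^sup>+\<omega>. ennreal (\<bar>X t \<omega> - X s \<omega>\<bar> powr p) \<partial>M)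
        * ennreal (\<bar>t - s\<bar> powr - (1 + \<sigma> * p)) \<partial>time_measure T) \<partial>time_measure T)
    \<le> ennreal ((A + real m * B) * (T / real m) powr (1 - b) * grid_constant T b)"
    unfolding b(3)[symmetric]
    by (rule double_integral_grid_bound[OF T m b(1,2) AB(1,2) same other])
  have "(\<integral>\<^sup>+\<omega>. frac_sobolev_energy T \<sigma> p (\<lambda>t. X t \<omega>) \<partial>M)
    \<le> ennreal (D * T) + ennreal ((A + real m * B) * (T / real m) powr (1 - b) * grid_constant T b)"
    unfolding expected_frac_sobolev_energy[OF M X] using 1 2 by (rule add_mono)
  also have "\<dots> = ennreal (D * T + (A + real m * B) * (T / real m) powr (1 - b) * grid_constant T b)"
    using AB T K by (intro ennreal_plus[symmetric]) auto
  finally show ?thesis .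
qed

section \<open>Step functions\<close>

lemma frac_sobolev_energy_cong:
  assumes "\<And>t. t \<in> {0<..<T} \<Longrightarrow> v t = w t"
  shows "frac_sobolev_energy T \<sigma> p v = frac_sobolev_energy T \<sigma> p w"
  unfolding frac_sobolev_energy_def using assms
  by (intro arg_cong2[where f = "(+)"] nn_integral_cong) auto

text \<open>Increments of a step function vanish within cells, so the deterministic kernel bound applies with
  \<open>A = 0\<close>. This is where \<open>\<sigma> p < 1\<close> is indispensable: for \<open>\<sigma> p \<ge> 1\<close> a jump has infinite energy.\<close>

lemma grid_step_function_in_frac_sobolev:
  fixes f :: "int \<Rightarrow> real"
  assumes T: "0 < T" and m: "0 < m" and \<sigma>p: "0 \<le> \<sigma> * p" "\<sigma> * p < 1" and p: "0 < p"
    and f: "\<And>i. \<bar>f i\<bar> \<le> R"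
  shows "(\<lambda>t. if t \<in> {0<..<T} then f (grid_index T m t) else 0) \<in> frac_sobolev T \<sigma> p"
proof -
  let ?v = "\<lambda>t. if t \<in> {0<..<T} then f (grid_index T m t) else 0"
  define b where "b = (1 + \<sigma> * p) / 2"
  have b: "1 / 2 \<le> b" "b < 1" "2 * b = 1 + \<sigma> * p" using \<sigma>p by (auto simp: b_def)
  have R: "0 \<le> R" using f[of 0] by linarith
  have [measurable]: "(\<lambda>t. grid_index T m t) \<in> borel \<rightarrow>\<^sub>M count_space UNIV"
    unfolding grid_index_def by measurable
  have "?v \<in> borel_measurable borel" by measurable
  then have meas: "?v \<in> borel_measurable (time_measure T)"
    by (rule measurable_lebesgue_on_borel)
  have bound: "\<bar>?v t - ?v s\<bar> \<le> 2 * R" for s t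
    using f[of "grid_index T m s"] f[of "grid_index T m t"] R by auto
  have "(\<integral>\<^sup>+s. (\<integral>\<^sup>+t. ennreal (\<bar>?v t - ?v s\<bar> powr p / \<bar>t - s\<bar> powr (1 + \<sigma> * p))
      \<partial>time_measure T) \<partial>time_measure T)
    = (\<integral>\<^sup>+s. (\<integral>\<^sup>+t. ennreal (\<bar>?v t - ?v s\<bar> powr p) * ennreal (\<bar>t - s\<bar> powr - (2 * b))
      \<partial>time_measure T) \<partial>time_measure T)"
    unfolding b(3) by (intro nn_integral_cong divide_powr_ennreal) simp
  also have "\<dots> \<le> ennreal ((0 + real m * ((2 * R) powr p)) * (T / real m) powr (1 - b) * grid_constant T b)"
  proof (rule double_integral_grid_bound[OF T m b(1,2)])
    show "ennreal (\<bar>?v t - ?v s\<bar> powr p) \<le> ennreal ((2 * R) powr p)" for s t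
      using bound p by (intro ennreal_leI powr_mono2) auto
  qed auto
  also have "\<dots> < \<infinity>" by simp
  finally have 1: "(\<integral>\<^sup>+s. (\<integral>\<^sup>+t. ennreal (\<bar>?v t - ?v s\<bar> powr p / \<bar>t - s\<bar> powr (1 + \<sigma> * p))
      \<partial>time_measure T) \<partial>time_measure T) < \<infinity>" .
  have "(\<integral>\<^sup>+t. ennreal (\<bar>?v t\<bar> powr p) \<partial>time_measure T) \<le> (\<integral>\<^sup>+t. ennreal (R powr p) \<partial>time_measure T)"
    using f R p by (intro nn_integral_mono ennreal_leI powr_mono2) auto
  also have "\<dots> < \<infinity>"
    using T by (simp add: emeasure_restrict_space ennreal_mult_less_top)
  finally have 2: "(\<integral>\<^sup>+t. ennreal (\<bar>?v t\<bar> powr p) \<partial>time_measure T) < \<infinity>" .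
  show ?thesis using meas 1 2 by (simp add: frac_sobolev_def frac_sobolev_energy_def)
qed

text \<open>Simple functions with values in a function space are obtained by composing a fixed map with a finite
  list of simple functions; lists serve because the number of entries varies with the grid.\<close>

lemma simple_function_map:
  assumes "\<And>i. i \<in> set xs \<Longrightarrow> simple_function M (f i)"
  shows "simple_function M (\<lambda>\<omega>. map (\<lambda>i. f i \<omega>) xs)"
  using assms
proof (induction xs)
  case (Cons i xs)
  have "simple_function M (\<lambda>\<omega>. (f i \<omega>, map (\<lambda>i. f i \<omega>) xs))"
    using Cons by (intro simple_function_Pair) auto
  from simple_function_compose1[OF this, of "\<lambda>(y, ys). y # ys"] show ?case by simp
qed simp

section \<open>Almost sure convergence from summable expectations\<close>

text \<open>The sum of the functions has finite expectation, hence is finite almost everywhere, and the terms of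
  a convergent series tend to zero.\<close>

lemma AE_tendsto_0_if_summable_nn_integral:
  fixes f :: "nat \<Rightarrow> 'w \<Rightarrow> ennreal"
  assumes [measurable]: "\<And>n. f n \<in> borel_measurable M"
    and le: "\<And>n. (\<integral>\<^sup>+\<omega>. f n \<omega> \<partial>M) \<le> ennreal (c n)" and c: "summable c" "\<And>n. 0 \<le> c n"
  shows "AE \<omega> in M. (\<lambda>n. enn2real (f n \<omega>)) \<longlonglongrightarrow> 0"
proof -
  have "(\<integral>\<^sup>+\<omega>. (\<Sum>n. f n \<omega>) \<partial>M) = (\<Sum>n. \<integral>\<^sup>+\<omega>. f n \<omega> \<partial>M)"
    by (rule nn_integral_suminf) simp
  also have "\<dots> \<le> (\<Sum>n. ennreal (c n))" by (intro suminf_le le) auto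
  also have "\<dots> < \<infinity>" using c by (simp add: suminf_ennreal2)
  finally have "AE \<omega> in M. (\<Sum>n. f n \<omega>) \<noteq> \<infinity>" by (intro nn_integral_noteq_infinite) auto
  then show ?thesis
  proof eventually_elim
    case (elim \<omega>)
    have fin: "ennreal (enn2real (f n \<omega>)) = f n \<omega>" for n
    proof -
      have "f n \<omega> \<le> (\<Sum>n. f n \<omega>)" using sum_le_suminf[of "\<lambda>n. f n \<omega>" "{n}"] by simp
      then show ?thesis using elim by (simp add: less_top top.not_eq_extremum le_less_trans)
    qed
    have "summable (\<lambda>n. enn2real (f n \<omega>))"
      using elim by (intro summable_suminf_not_top) (auto simp: fin)
    then show ?case by (rule summable_LIMSEQ_zero)
  qed
qed

section \<open>Counting processes with linear increment moments\<close>

lemma abs_add_powr_le: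
  fixes x y p :: real
  assumes "0 \<le> p"
  shows "\<bar>x + y\<bar> powr p \<le> 2 powr p * (\<bar>x\<bar> powr p + \<bar>y\<bar> powr p)"
proof -
  have "\<bar>x + y\<bar> powr p \<le> (2 * max \<bar>x\<bar> \<bar>y\<bar>) powr p"
    using assms by (intro powr_mono2) auto
  also have "\<dots> = 2 powr p * max \<bar>x\<bar> \<bar>y\<bar> powr p" by (simp add: powr_mult)
  also have "\<dots> \<le> 2 powr p * (\<bar>x\<bar> powr p + \<bar>y\<bar> powr p)"
    by (intro mult_left_mono) (auto simp: max_def)
  finally show ?thesis .
qed

text \<open>The Poisson law enters the argument through the linear moment bound and through monotonicity, so the
  rest is done for jointly measurable \<open>\<nat>\<close>-valued processes with these properties that start at zero.
  Monotonicity is demanded for each pair of times separately, with an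
  exceptional set depending on the pair; the proofs evaluate it at countably many times.\<close>

context
  fixes M :: "'w measure" and T \<sigma> p C :: real and N :: "real \<Rightarrow> 'w \<Rightarrow> nat"
  assumes M: "sigma_finite_measure M"
    and T: "0 < T" and \<sigma>p: "0 \<le> \<sigma> * p" "\<sigma> * p < 1" and p: "0 < p" and C: "0 \<le> C"
    and joint: "(\<lambda>(t, \<omega>). real (N t \<omega>)) \<in> borel_measurable (restrict_space borel {0..T} \<Otimes>\<^sub>M M)"
    and increments: "\<And>s t. s \<in> {0..T} \<Longrightarrow> t \<in> {0..T} \<Longrightarrow>
      (\<integral>\<^sup>+\<omega>. ennreal (\<bar>real (N t \<omega>) - real (N s \<omega>)\<bar> powr p) \<partial>M) \<le> ennreal (C * \<bar>t - s\<bar>)"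
    and start: "AE \<omega> in M. N 0 \<omega> = 0"
    and mono: "\<And>s t. 0 \<le> s \<Longrightarrow> s \<le> t \<Longrightarrow> t \<le> T \<Longrightarrow> AE \<omega> in M. N s \<omega> \<le> N t \<omega>"
begin

lemma process_moment:
  assumes "t \<in> {0..T}"
  shows "(\<integral>\<^sup>+\<omega>. ennreal (\<bar>real (N t \<omega>)\<bar> powr p) \<partial>M) \<le> ennreal (C * t)"
proof -
  have "(\<integral>\<^sup>+\<omega>. ennreal (\<bar>real (N t \<omega>)\<bar> powr p) \<partial>M)
    = (\<integral>\<^sup>+\<omega>. ennreal (\<bar>real (N t \<omega>) - real (N 0 \<omega>)\<bar> powr p) \<partial>M)"
    by (rule nn_integral_cong_AE) (use start in eventually_elim, simp)
  also have "\<dots> \<le> ennreal (C * \<bar>t - 0\<bar>)" using assms by (intro increments) auto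
  finally show ?thesis using assms by simp
qed

lemma process_time_changed_measurable:
  assumes f: "f \<in> borel_measurable borel" "\<And>t. t \<in> {0<..<T} \<Longrightarrow> f t \<in> {0..T}"
  shows "(\<lambda>(t, \<omega>). real (N (f t) \<omega>)) \<in> borel_measurable (time_measure T \<Otimes>\<^sub>M M)"
proof -
  have "f \<in> time_measure T \<rightarrow>\<^sub>M restrict_space borel {0..T}"
    using f by (intro measurable_restrict_space2 measurable_lebesgue_on_borel) auto
  then have "(\<lambda>z. (f (fst z), snd z)) \<in> time_measure T \<Otimes>\<^sub>M M \<rightarrow>\<^sub>M restrict_space borel {0..T} \<Otimes>\<^sub>M M"
    by (intro measurable_Pair measurable_compose[OF measurable_fst] measurable_snd)
  from measurable_compose[OF this joint] show ?thesis by (simp add: case_prod_beta)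
qed

lemma process_measurable: "(\<lambda>(t, \<omega>). real (N t \<omega>)) \<in> borel_measurable (time_measure T \<Otimes>\<^sub>M M)"
  by (rule process_time_changed_measurable[of "\<lambda>t. t"]) auto

lemma process_section_measurable:
  assumes "t \<in> {0..T}"
  shows "N t \<in> measurable M (count_space UNIV)"
proof -
  have "(\<lambda>\<omega>. (t, \<omega>)) \<in> M \<rightarrow>\<^sub>M restrict_space borel {0..T} \<Otimes>\<^sub>M M"
    using assms by (intro measurable_Pair1') (auto simp: space_restrict_space)
  from measurable_compose[OF this joint] have "(\<lambda>\<omega>. real (N t \<omega>)) \<in> borel_measurable M" by simp
  then have "(\<lambda>\<omega>. nat \<lfloor>real (N t \<omega>)\<rfloor>) \<in> measurable M (count_space UNIV)" by measurable
  then show ?thesis by simp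
qed

text \<open>A grid with a single cell: all pairs of times belong to the same cell, so only the linear bound on
  the increments is used.\<close>

lemma expected_process_energy_finite:
  "(\<integral>\<^sup>+\<omega>. frac_sobolev_energy T \<sigma> p (\<lambda>t. real (N t \<omega>)) \<partial>M) < \<infinity>"
proof -
  have idx: "grid_index T 1 t = 0" if "t \<in> {0<..<T}" for t
    using grid_index_range[of T 1 t] T that by simp
  have mom: "(\<integral>\<^sup>+\<omega>. ennreal (\<bar>real (N t \<omega>)\<bar> powr p) \<partial>M) \<le> ennreal (C * T)"
    if t: "t \<in> {0<..<T}" for t
  proof -
    have "(\<integral>\<^sup>+\<omega>. ennreal (\<bar>real (N t \<omega>)\<bar> powr p) \<partial>M) \<le> ennreal (C * t)"
      using t by (intro process_moment) auto
    also have "\<dots> \<le> ennreal (C * T)" using t C by (intro ennreal_leI mult_left_mono) auto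
    finally show ?thesis .
  qed
  have "(\<integral>\<^sup>+\<omega>. frac_sobolev_energy T \<sigma> p (\<lambda>t. real (N t \<omega>)) \<partial>M)
    \<le> ennreal (C * T * T + (C + real 1 * 0) * (T / real 1) powr (1 - (1 + \<sigma> * p) / 2)
        * grid_constant T ((1 + \<sigma> * p) / 2))"
    using C T \<sigma>p mom increments idx
    by (intro expected_energy_grid_bound[OF M process_measurable]) auto
  also have "\<dots> < \<infinity>" by simp
  finally show ?thesis .
qed

lemma process_paths_in_frac_sobolev: "AE \<omega> in M. (\<lambda>t. real (N t \<omega>)) \<in> frac_sobolev T \<sigma> p"
proof -
  have "AE \<omega> in M. frac_sobolev_energy T \<sigma> p (\<lambda>t. real (N t \<omega>)) \<noteq> \<infinity>"
    using expected_process_energy_finite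
    by (intro nn_integral_noteq_infinite frac_sobolev_energy_measurable[OF M process_measurable]) auto
  then show ?thesis using AE_space
  proof eventually_elim
    case (elim \<omega>)
    have "(\<lambda>t. (t, \<omega>)) \<in> time_measure T \<rightarrow>\<^sub>M time_measure T \<Otimes>\<^sub>M M"
      using elim by (intro measurable_Pair2') auto
    from measurable_compose[OF this process_measurable]
    have "(\<lambda>t. real (N t \<omega>)) \<in> borel_measurable (time_measure T)" by simp
    then show ?case using elim by (simp add: frac_sobolev_def less_top)
  qed
qed

text \<open>The \<open>p\<close>-th power of the norm is the energy with \<open>\<infinity>\<close> replaced by \<open>0\<close>, hence at most the
  energy.\<close>

lemma process_norm_moment:
  "(\<integral>\<^sup>+\<omega>. ennreal (frac_sobolev_norm T \<sigma> p (\<lambda>t. real (N t \<omega>)) powr p) \<partial>M) < \<infinity>"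
proof -
  have "ennreal (frac_sobolev_norm T \<sigma> p v powr p) \<le> frac_sobolev_energy T \<sigma> p v" for v
    using p ennreal_enn2real_if[of "frac_sobolev_energy T \<sigma> p v"]
    by (simp add: frac_sobolev_norm_def powr_powr)
  then have "(\<integral>\<^sup>+\<omega>. ennreal (frac_sobolev_norm T \<sigma> p (\<lambda>t. real (N t \<omega>)) powr p) \<partial>M)
    \<le> (\<integral>\<^sup>+\<omega>. frac_sobolev_energy T \<sigma> p (\<lambda>t. real (N t \<omega>)) \<partial>M)"
    by (intro nn_integral_mono) auto
  then show ?thesis using expected_process_energy_finite by (rule le_less_trans)
qed

definition grid_error :: "nat \<Rightarrow> real \<Rightarrow> 'w \<Rightarrow> real" where
  "grid_error m t \<omega> = real (N (grid_point T m t) \<omega>) - real (N t \<omega>)"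

lemma grid_error_measurable:
  assumes "0 < m"
  shows "(\<lambda>(t, \<omega>). grid_error m t \<omega>) \<in> borel_measurable (time_measure T \<Otimes>\<^sub>M M)"
proof -
  have "(\<lambda>(t, \<omega>). real (N (grid_point T m t) \<omega>)) \<in> borel_measurable (time_measure T \<Otimes>\<^sub>M M)"
    using grid_point_in_interval[OF T assms]
    by (intro process_time_changed_measurable) auto
  from borel_measurable_diff[OF this process_measurable] show ?thesis
    by (simp add: grid_error_def case_prod_beta)
qed

lemma grid_error_section_measurable:
  assumes "0 < m" "t \<in> {0<..<T}"
  shows "grid_error m t \<in> borel_measurable M"
proof -
  have [measurable]: "N t \<in> measurable M (count_space UNIV)"
    "N (grid_point T m t) \<in> measurable M (count_space UNIV)"
    using process_section_measurable[of t] process_section_measurable[OF grid_point_in_interval[OF T assms]]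
      assms by auto
  show ?thesis unfolding grid_error_def[abs_def] by measurable
qed

lemma grid_error_moment:
  assumes m: "0 < m" and t: "t \<in> {0<..<T}"
  shows "(\<integral>\<^sup>+\<omega>. ennreal (\<bar>grid_error m t \<omega>\<bar> powr p) \<partial>M) \<le> ennreal (C * (T / real m))"
proof -
  have "(\<integral>\<^sup>+\<omega>. ennreal (\<bar>grid_error m t \<omega>\<bar> powr p) \<partial>M) \<le> ennreal (C * \<bar>grid_point T m t - t\<bar>)"
    unfolding grid_error_def using t grid_point_in_interval[OF T m t] by (intro increments) auto
  also have "\<dots> \<le> ennreal (C * (T / real m))"
    using grid_point_bounds[OF T m, of t] C by (intro ennreal_leI mult_left_mono) auto
  finally show ?thesis .
qed

text \<open>Within a cell the sampled values cancel and the error has the increments of the process. Across cells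
  nothing better than the sum of the two errors is used: each has \<open>p\<close>-th moment of the order of the
  mesh, which compensates the number \<open>m\<close> of cells.\<close>

lemma expected_grid_error_energy:
  assumes m: "0 < m"
  shows "(\<integral>\<^sup>+\<omega>. frac_sobolev_energy T \<sigma> p (\<lambda>t. grid_error m t \<omega>) \<partial>M)
    \<le> ennreal (C * (T / real m) * T + (C + real m * (2 powr p * (2 * (C * (T / real m)))))
        * (T / real m) powr (1 - (1 + \<sigma> * p) / 2) * grid_constant T ((1 + \<sigma> * p) / 2))"
proof (rule expected_energy_grid_bound[OF M grid_error_measurable[OF m] T m \<sigma>p C])
  fix s t assume s: "s \<in> {0<..<T}" and t: "t \<in> {0<..<T}"
  show "(\<integral>\<^sup>+\<omega>. ennreal (\<bar>grid_error m t \<omega> - grid_error m s \<omega>\<bar> powr p) \<partial>M) \<le> ennreal (C * \<bar>t - s\<bar>)"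
    if "grid_index T m s = grid_index T m t"
  proof -
    have "\<bar>grid_error m t \<omega> - grid_error m s \<omega>\<bar> = \<bar>real (N t \<omega>) - real (N s \<omega>)\<bar>" for \<omega>
      using that by (simp add: grid_error_def grid_point_def)
    then show ?thesis using increments[of s t] s t by auto
  qed
  have [measurable]: "grid_error m t \<in> borel_measurable M" "grid_error m s \<in> borel_measurable M"
    using grid_error_section_measurable[OF m] s t by auto
  have "(\<integral>\<^sup>+\<omega>. ennreal (\<bar>grid_error m t \<omega> - grid_error m s \<omega>\<bar> powr p) \<partial>M)
    \<le> (\<integral>\<^sup>+\<omega>. ennreal (2 powr p) * (ennreal (\<bar>grid_error m t \<omega>\<bar> powr p)
        + ennreal (\<bar>grid_error m s \<omega>\<bar> powr p)) \<partial>M)"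
  proof (rule nn_integral_mono)
    fix \<omega>
    have "\<bar>grid_error m t \<omega> - grid_error m s \<omega>\<bar> powr p
      \<le> 2 powr p * (\<bar>grid_error m t \<omega>\<bar> powr p + \<bar>grid_error m s \<omega>\<bar> powr p)"
      using abs_add_powr_le[of p "grid_error m t \<omega>" "- grid_error m s \<omega>"] p by simp
    from ennreal_leI[OF this]
    show "ennreal (\<bar>grid_error m t \<omega> - grid_error m s \<omega>\<bar> powr p)
      \<le> ennreal (2 powr p) * (ennreal (\<bar>grid_error m t \<omega>\<bar> powr p)
        + ennreal (\<bar>grid_error m s \<omega>\<bar> powr p))"
      by (simp add: ennreal_mult)
  qed
  also have "\<dots> = ennreal (2 powr p) * ((\<integral>\<^sup>+\<omega>. ennreal (\<bar>grid_error m t \<omega>\<bar> powr p) \<partial>M)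
        + (\<integral>\<^sup>+\<omega>. ennreal (\<bar>grid_error m s \<omega>\<bar> powr p) \<partial>M))"
    by (simp add: nn_integral_cmult nn_integral_add)
  also have "\<dots> \<le> ennreal (2 powr p) * (ennreal (C * (T / real m)) + ennreal (C * (T / real m)))"
    using s t by (intro mult_left_mono add_mono grid_error_moment m) auto
  also have "\<dots> = ennreal (2 powr p * (2 * (C * (T / real m))))"
    using C T by (simp add: ennreal_mult'[symmetric] ennreal_plus[symmetric] del: ennreal_plus)
  finally show "(\<integral>\<^sup>+\<omega>. ennreal (\<bar>grid_error m t \<omega> - grid_error m s \<omega>\<bar> powr p) \<partial>M)
    \<le> ennreal (2 powr p * (2 * (C * (T / real m))))" .
qed (use C T grid_error_moment[OF m] in auto)

text \<open>The expected energy decays like a fixed power of the mesh, and the mesh is halved in each step.\<close>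

lemma dyadic_grid_error_tendsto_0:
  "AE \<omega> in M. (\<lambda>n. frac_sobolev_norm T \<sigma> p (\<lambda>t. grid_error (2 ^ n) t \<omega>)) \<longlonglongrightarrow> 0"
proof -
  define e where "e = 1 - (1 + \<sigma> * p) / 2"
  have e: "0 < e" using \<sigma>p by (simp add: e_def)
  define K where "K = grid_constant T ((1 + \<sigma> * p) / 2)"
  have K: "0 \<le> K" using \<sigma>p T by (simp add: K_def grid_constant_def)
  define c where "c n = C * (T / 2 ^ n) * T
    + (C + 2 ^ n * (2 powr p * (2 * (C * (T / 2 ^ n))))) * (T / 2 ^ n) powr e * K" for n :: nat
  have c_eq: "c n = C * T * T * (1 / 2) ^ n
    + (C + 2 powr p * (2 * (C * T))) * T powr e * K * (2 powr - e) ^ n" for n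
  proof -
    have "(2 ^ n) powr e = (2 powr e) ^ n"
      by (simp add: powr_realpow[symmetric] powr_powr mult.commute)
    moreover have "(T / 2 ^ n) powr e = T powr e / (2 ^ n) powr e"
      by (simp add: powr_divide)
    ultimately have decay: "(T / 2 ^ n) powr e = T powr e * (2 powr - e) ^ n"
      by (simp add: powr_minus power_inverse divide_inverse)
    (* The number of cells and the mesh cancel, and only the power e of the mesh is left. *)
    have cells: "2 ^ n * (2 powr p * (2 * (C * (T / 2 ^ n)))) = 2 powr p * (2 * (C * T))" by simp
    have "C * (T / 2 ^ n) * T = C * T * T * (1 / 2) ^ n" by (simp add: power_one_over)
    then show ?thesis unfolding c_def decay cells by (simp only: mult_ac)
  qed
  have "summable c"
    unfolding c_eq[abs_def] using e
    by (intro summable_add summable_mult summable_geometric) (auto simp: powr_less_one)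
  moreover have "0 \<le> c n" for n using C T K by (simp add: c_def)
  moreover have "(\<integral>\<^sup>+\<omega>. frac_sobolev_energy T \<sigma> p (\<lambda>t. grid_error (2 ^ n) t \<omega>) \<partial>M) \<le> ennreal (c n)" for n
    using expected_grid_error_energy[of "2 ^ n"] by (simp add: c_def e_def K_def)
  moreover have "(\<lambda>\<omega>. frac_sobolev_energy T \<sigma> p (\<lambda>t. grid_error (2 ^ n) t \<omega>)) \<in> borel_measurable M" for n
    by (rule frac_sobolev_energy_measurable[OF M grid_error_measurable]) simp
  ultimately have "AE \<omega> in M. (\<lambda>n. enn2real (frac_sobolev_energy T \<sigma> p (\<lambda>t. grid_error (2 ^ n) t \<omega>))) \<longlonglongrightarrow> 0"
    by (intro AE_tendsto_0_if_summable_nn_integral)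
  then show ?thesis
  proof eventually_elim
    case (elim \<omega>)
    from tendsto_zero_powrI[OF elim tendsto_const[of "1 / p"]] show ?case
      using p by (simp add: frac_sobolev_norm_def)
  qed
qed

text \<open>The cut-off at \<open>n\<close> makes the range finite. The value \<open>0\<close> outside \<open>(0,T)\<close> is needed too: there the
  grid indices are unbounded, so infinitely many different functions could arise, and the process is not assumed measurable.\<close>

definition grid_approximation :: "nat \<Rightarrow> 'w \<Rightarrow> real \<Rightarrow> real" where
  "grid_approximation n \<omega> = (\<lambda>t. if t \<in> {0<..<T}
    then real (min n (N (of_int (grid_index T (2 ^ n) t) * (T / 2 ^ n)) \<omega>)) else 0)"

lemma simple_function_grid_approximation: "simple_function M (grid_approximation n)"
proof -
  define V where "V i \<omega> = min n (N (real i * (T / 2 ^ n)) \<omega>)" for i \<omega>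
  have "simple_function M (V i)" if i: "i \<in> set [0..<2 ^ n]" for i
  proof -
    have "real i < 2 ^ n" using i by (simp flip: of_nat_less_iff)
    then have "real i * (T / 2 ^ n) \<in> {0..T}" using T by (simp add: field_simps)
    then have [measurable]: "N (real i * (T / 2 ^ n)) \<in> measurable M (count_space UNIV)"
      by (rule process_section_measurable)
    have "V i ` space M \<subseteq> {..n}" by (auto simp: V_def)
    then have "finite (V i ` space M)" by (rule finite_subset) simp
    moreover have "V i \<in> measurable M (count_space UNIV)" unfolding V_def[abs_def] by measurable
    ultimately show ?thesis by (simp add: simple_function_eq_measurable)
  qed
  then have "simple_function M (\<lambda>\<omega>. map (\<lambda>i. V i \<omega>) [0..<2 ^ n])"
    by (rule simple_function_map)
  then have "simple_function M (\<lambda>\<omega>. (\<lambda>ys t. if t \<in> {0<..<T}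
      then real (ys ! nat (grid_index T (2 ^ n) t)) else 0) (map (\<lambda>i. V i \<omega>) [0..<2 ^ n]))"
    by (rule simple_function_compose1)
  also have "(\<lambda>\<omega>. (\<lambda>ys t. if t \<in> {0<..<T}
      then real (ys ! nat (grid_index T (2 ^ n) t)) else 0) (map (\<lambda>i. V i \<omega>) [0..<2 ^ n]))
    = grid_approximation n"
  proof (intro ext)
    fix \<omega> t
    show "(\<lambda>ys t. if t \<in> {0<..<T} then real (ys ! nat (grid_index T (2 ^ n) t)) else 0)
        (map (\<lambda>i. V i \<omega>) [0..<2 ^ n]) t = grid_approximation n \<omega> t"
    proof (cases "t \<in> {0<..<T}")
      case True
      then have "0 \<le> grid_index T (2 ^ n) t" "nat (grid_index T (2 ^ n) t) < 2 ^ n"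
        using grid_index_range[of T "2 ^ n" t] T by (auto simp: nat_less_iff)
      then show ?thesis using True by (simp add: grid_approximation_def V_def)
    qed (auto simp: grid_approximation_def)
  qed
  finally show ?thesis .
qed

lemma grid_approximation_in_frac_sobolev: "grid_approximation n \<omega> \<in> frac_sobolev T \<sigma> p"
  unfolding grid_approximation_def
  by (rule grid_step_function_in_frac_sobolev[where R = "real n" and m = "2 ^ n"
        and f = "\<lambda>i. real (min n (N (of_int i * (T / 2 ^ n)) \<omega>))"]) (use T \<sigma>p p in auto)

text \<open>The values at all dyadic times are bounded by the value at \<open>T\<close>, outside one null set. From
  \<open>n = N T\<close> on the truncation therefore changes nothing, and the error is exactly the sampling error.\<close>

lemma grid_approximation_tendsto:
  "AE \<omega> in M. (\<lambda>n. frac_sobolev_norm T \<sigma> p (\<lambda>t. grid_approximation n \<omega> t - real (N t \<omega>))) \<longlonglongrightarrow> 0"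
proof -
  have "AE \<omega> in M. \<forall>n i. i < 2 ^ n \<longrightarrow> N (real i * (T / 2 ^ n)) \<omega> \<le> N T \<omega>"
    unfolding AE_all_countable
  proof (intro allI)
    fix n i :: nat
    show "AE \<omega> in M. i < 2 ^ n \<longrightarrow> N (real i * (T / 2 ^ n)) \<omega> \<le> N T \<omega>"
    proof (cases "i < 2 ^ n")
      case True
      then have "real i < 2 ^ n" by (simp flip: of_nat_less_iff)
      then have "AE \<omega> in M. N (real i * (T / 2 ^ n)) \<omega> \<le> N T \<omega>"
        using T by (intro mono) (auto simp: field_simps)
      then show ?thesis by eventually_elim simp
    qed simp
  qed
  with dyadic_grid_error_tendsto_0 show ?thesis
  proof eventually_elim
    case (elim \<omega>)
    have eq: "frac_sobolev_norm T \<sigma> p (\<lambda>t. grid_error (2 ^ n) t \<omega>)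
      = frac_sobolev_norm T \<sigma> p (\<lambda>t. grid_approximation n \<omega> t - real (N t \<omega>))"
      if n: "N T \<omega> \<le> n" for n
    proof -
      have "grid_error (2 ^ n) t \<omega> = grid_approximation n \<omega> t - real (N t \<omega>)"
        if t: "t \<in> {0<..<T}" for t
      proof -
        have i: "0 \<le> grid_index T (2 ^ n) t" "nat (grid_index T (2 ^ n) t) < 2 ^ n"
          using grid_index_range[of T "2 ^ n" t] T t by (auto simp: nat_less_iff)
        then have "N (real (nat (grid_index T (2 ^ n) t)) * (T / 2 ^ n)) \<omega> \<le> n"
          using elim n by (meson order_trans)
        then show ?thesis
          using i(1) t by (simp add: grid_error_def grid_approximation_def grid_point_def)
      qed
      then show ?thesis
        unfolding frac_sobolev_norm_def by (intro arg_cong2[where f = "(powr)"] arg_cong[where f = enn2real]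
            frac_sobolev_energy_cong) auto
    qed
    show ?case
      using elim(1) by (rule Lim_transform_eventually) (use eq in \<open>auto simp: eventually_sequentially\<close>)
  qed
qed

lemma process_in_Lp_frac_sobolev: "(\<lambda>t \<omega>. real (N t \<omega>)) \<in> Lp_frac_sobolev M T \<sigma> p"
  unfolding Lp_frac_sobolev_def
  using process_paths_in_frac_sobolev process_norm_moment grid_approximation_tendsto
    simple_function_grid_approximation grid_approximation_in_frac_sobolev
  by (intro CollectI conjI exI[of _ grid_approximation]) auto

text \<open>The moment integral is linear in \<open>h\<close>, and on a bounded range \<open>h\<close> is dominated by any power of it with
  exponent at most one.\<close>

lemma initial_moment_le:
  assumes h: "h \<in> {0<..T}" and e: "e \<le> 1"
  shows "initial_moment M p (\<lambda>t \<omega>. real (N t \<omega>)) h \<le> ennreal (C * T * T powr (1 - e) * h powr e)"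
proof -
  have "initial_moment M p (\<lambda>t \<omega>. real (N t \<omega>)) h \<le> (\<integral>\<^sup>+t. ennreal (C * T) * indicator {0..h} t \<partial>lborel)"
    unfolding initial_moment_def
  proof (rule nn_integral_mono)
    fix t
    have "(\<integral>\<^sup>+\<omega>. ennreal (\<bar>real (N t \<omega>)\<bar> powr p) \<partial>M) \<le> ennreal (C * T)" if "t \<in> {0..h}"
    proof -
      have "(\<integral>\<^sup>+\<omega>. ennreal (\<bar>real (N t \<omega>)\<bar> powr p) \<partial>M) \<le> ennreal (C * t)"
        using that h by (intro process_moment) auto
      also have "\<dots> \<le> ennreal (C * T)" using that h C by (intro ennreal_leI mult_left_mono) auto
      finally show ?thesis .
    qed
    then show "(\<integral>\<^sup>+\<omega>. ennreal (\<bar>real (N t \<omega>)\<bar> powr p) \<partial>M) * indicator {0..h} t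
      \<le> ennreal (C * T) * indicator {0..h} t"
      by (auto split: split_indicator)
  qed
  also have "\<dots> = ennreal (C * T * h)"
    using h C T by (simp add: nn_integral_cmult_indicator ennreal_mult)
  also have "\<dots> \<le> ennreal (C * T * T powr (1 - e) * h powr e)"
  proof (rule ennreal_leI)
    have "h = h powr (1 - e) * h powr e" using h by (simp add: powr_add[symmetric])
    also have "\<dots> \<le> T powr (1 - e) * h powr e"
      using h e by (intro mult_right_mono powr_mono2) auto
    finally show "C * T * h \<le> C * T * T powr (1 - e) * h powr e"
      using C T unfolding mult.assoc by (intro mult_left_mono) auto
  qed
  finally show ?thesis .
qed

end

section \<open>Poisson processes\<close>

theorem theorem6p4:
  fixes M :: "'w measure" and F :: "real \<Rightarrow> 'w measure" and T a :: real
    and N :: "real \<Rightarrow> 'w \<Rightarrow> nat"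
  assumes "usual_filtered_prob_space M F T"
    and "0 < a"
    and "poisson_process M T a N"
  shows "(\<forall>p \<sigma>. 2 \<le> p \<and> 0 < \<sigma> \<and> \<sigma> < 1 \<and> \<sigma> * p < 1 \<longrightarrow>
      (\<lambda>t \<omega>. real (N t \<omega>)) \<in> Lp_frac_sobolev M T \<sigma> p \<and>
      (\<forall>h0\<in>{0<..T}. \<exists>C0>0. \<forall>h\<in>{0<..h0}.
        initial_moment M p (\<lambda>t \<omega>. real (N t \<omega>)) h
          \<le> ennreal (C0 * h powr max 0 (p * \<sigma> - (p - 2) / 2)))) \<and>
    (adapted_process F T (\<lambda>t \<omega>. real (N t \<omega>)) \<longrightarrow>
      (\<forall>p \<sigma>. 2 \<le> p \<and> 0 < \<sigma> \<and> \<sigma> < 1 \<and> \<sigma> * p < 1 \<longrightarrow>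
        admissible_integrand M F T \<sigma> p (\<lambda>t \<omega>. real (N t \<omega>))))"
proof -
  interpret usual_filtered_prob_space M F T by (rule assms(1))
  note T = T_pos
  have right: "((\<lambda>r. real (N r \<omega>)) \<longlongrightarrow> real (N s \<omega>)) (at_right s)"
    if "s \<in> {0..<T}" "\<omega> \<in> space M" for s \<omega>
    using assms(3) that unfolding poisson_process_def cadlag_on_def by auto
  have start: "AE \<omega> in M. N 0 \<omega> = 0"
    using assms(3) unfolding poisson_process_def by blast
  have sections: "(\<lambda>\<omega>. real (N t \<omega>)) \<in> borel_measurable M" if "t \<in> {0..T}" for t
    using measurable_compose[OF poisson_process_measurable[OF prob_space_axioms assms(3) that],
        of real borel] by simp
  have joint: "(\<lambda>(t, \<omega>). real (N t \<omega>)) \<in> borel_measurable (restrict_space borel {0..T} \<Otimes>\<^sub>M M)"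
    using T sections right by (intro right_continuous_jointly_measurable) auto
  have main: "(\<lambda>t \<omega>. real (N t \<omega>)) \<in> Lp_frac_sobolev M T \<sigma> p"
    "\<exists>C0>0. \<forall>h\<in>{0<..T}. initial_moment M p (\<lambda>t \<omega>. real (N t \<omega>)) h
        \<le> ennreal (C0 * h powr max 0 (p * \<sigma> - (p - 2) / 2))"
    if p: "2 \<le> p" and \<sigma>: "0 < \<sigma>" "\<sigma> * p < 1" for p \<sigma> :: real
  proof -
    obtain C where C: "0 < C" "\<forall>s\<in>{0..T}. \<forall>t\<in>{0..T}.
        (\<integral>\<^sup>+\<omega>. ennreal (\<bar>real (N t \<omega>) - real (N s \<omega>)\<bar> powr p) \<partial>M) \<le> ennreal (C * \<bar>t - s\<bar>)"
      using poisson_process_increment_moment[OF prob_space_axioms assms(3,2) T, of p] by blast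
    have \<sigma>p: "0 \<le> \<sigma> * p" and p0: "0 < p" and C0: "0 \<le> C" using p \<sigma> C by auto
    note ctx = sigma_finite_measure_axioms T \<sigma>p \<sigma>(2) p0 C0 joint C(2)[rule_format] start
      poisson_process_mono_AE[OF prob_space_axioms assms(3)]
    show "(\<lambda>t \<omega>. real (N t \<omega>)) \<in> Lp_frac_sobolev M T \<sigma> p"
      by (rule process_in_Lp_frac_sobolev[OF ctx])
    let ?e = "max 0 (p * \<sigma> - (p - 2) / 2)"
    have "p * \<sigma> < 1" "0 \<le> (p - 2) / 2" using p \<sigma> by (simp_all add: mult.commute)
    then have "?e \<le> 1" by linarith
    then have "\<forall>h\<in>{0<..T}. initial_moment M p (\<lambda>t \<omega>. real (N t \<omega>)) h
        \<le> ennreal (C * T * T powr (1 - ?e) * h powr ?e)"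
      using initial_moment_le[OF ctx] by blast
    then show "\<exists>C0>0. \<forall>h\<in>{0<..T}. initial_moment M p (\<lambda>t \<omega>. real (N t \<omega>)) h
        \<le> ennreal (C0 * h powr ?e)"
      using C(1) T by (intro exI[of _ "C * T * T powr (1 - ?e)"]) auto
  qed
  have progressive: "progressively_measurable F T (\<lambda>t \<omega>. real (N t \<omega>))"
    if ad: "adapted_process F T (\<lambda>t \<omega>. real (N t \<omega>))"
    unfolding progressively_measurable_def
  proof (intro ballI right_continuous_jointly_measurable)
    fix t assume t: "t \<in> {0..T}"
    have space: "space (F t) = space M" using subalg[OF t] by (simp add: subalgebra_def)
    show "(\<lambda>\<omega>. real (N s \<omega>)) \<in> borel_measurable (F t)" if s: "s \<in> {0..t}" for s
    proof (rule measurable_from_subalg)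
      show "(\<lambda>\<omega>. real (N s \<omega>)) \<in> borel_measurable (F s)"
        using ad s t by (auto simp: adapted_process_def)
      have "space (F s) = space M" using subalg[of s] s t by (simp add: subalgebra_def)
      then show "subalgebra (F t) (F s)"
        using s t space filtration_mono[of s t] by (simp add: subalgebra_def)
    qed
    show "((\<lambda>r. real (N r \<omega>)) \<longlongrightarrow> real (N s \<omega>)) (at_right s)"
      if "s \<in> {0..<t}" "\<omega> \<in> space (F t)" for s \<omega>
      using that t space by (intro right) auto
  qed auto
  have initial: "\<forall>h0\<in>{0<..T}. \<exists>C0>0. \<forall>h\<in>{0<..h0}.
        initial_moment M p (\<lambda>t \<omega>. real (N t \<omega>)) h
          \<le> ennreal (C0 * h powr max 0 (p * \<sigma> - (p - 2) / 2))"
    if p\<sigma>: "2 \<le> p" "0 < \<sigma>" "\<sigma> * p < 1" for p \<sigma> :: real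
  proof
    fix h0 assume h0: "h0 \<in> {0<..T}"
    obtain C0 where C0: "0 < C0" "\<And>h. h \<in> {0<..T} \<Longrightarrow> initial_moment M p (\<lambda>t \<omega>. real (N t \<omega>)) h
        \<le> ennreal (C0 * h powr max 0 (p * \<sigma> - (p - 2) / 2))"
      using main(2)[OF p\<sigma>] by blast
    show "\<exists>C0>0. \<forall>h\<in>{0<..h0}. initial_moment M p (\<lambda>t \<omega>. real (N t \<omega>)) h
        \<le> ennreal (C0 * h powr max 0 (p * \<sigma> - (p - 2) / 2))"
      using h0 by (intro exI[of _ C0] conjI ballI C0) auto
  qed
  have T_mem: "T \<in> {0<..T}" using T by simp
  show ?thesis
  proof (intro conjI allI impI, goal_cases)
    case (1 p \<sigma>)
    then have p\<sigma>: "2 \<le> p" "0 < \<sigma>" "\<sigma> * p < 1" by simp_all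
    show ?case by (rule main(1)[OF p\<sigma>])
  next
    case (2 p \<sigma>)
    then have p\<sigma>: "2 \<le> p" "0 < \<sigma>" "\<sigma> * p < 1" by simp_all
    show ?case by (rule initial[OF p\<sigma>])
  next
    case (3 p \<sigma>)
    then have p\<sigma>: "2 \<le> p" "0 < \<sigma>" "\<sigma> * p < 1" by simp_all
    obtain C0 where C0: "0 < C0" "\<forall>h\<in>{0<..T}. initial_moment M p (\<lambda>t \<omega>. real (N t \<omega>)) h
        \<le> ennreal (C0 * h powr max 0 (p * \<sigma> - (p - 2) / 2))"
      using main(2)[OF p\<sigma>] by blast
    show ?case
      unfolding admissible_integrand_def
      by (intro conjI progressive 3(1) main(1)[OF p\<sigma>] exI[of _ C0] bexI[OF _ T_mem] C0)
  qed
qed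

end
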